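(* Let $(A_1,\cdot_1,\diamond_1,\varepsilon,\alpha_1)$ and $(A_2,\cdot_2,\diamond_2,\varepsilon,\alpha_2)$ be admissible Hom-Novikov-Poisson color Hom-algebras (graded by the same abelian group $\Gamma$, with the same commutation factor $\varepsilon$), and let $A=A_1\otimes A_2$. Define $\alpha:A\to A$ by $\alpha=\alpha_1\otimes\alpha_2$ and define the operations $\cdot,\diamond:A\otimes A\to A$ by (bilinearly extending), for all $x_i,y_i\in\mathcal H(A_i)$, $i\in\{1,2\}$, $$(x_1\otimes x_2)\cdot(y_1\otimes y_2)=\varepsilon(x_2,y_1)\,(x_1\cdot_1 y_1)\otimes(x_2\cdot_2 y_2),$$ $$(x_1\otimes x_2)\diamond(y_1\otimes y_2)=\varepsilon(x_2,y_1)\big((x_1\diamond_1 y_1)\otimes(x_2\cdot_2 y_2)+(x_1\cdot_1 y_1)\otimes(x_2\diamond_2 y_2)\big).$$ Then $(A,\cdot,\diamond,\varepsilon,\alpha)$ is an admissible Hom-Novikov-Poisson color Hom-algebra.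
   Context: $\mathbb K$ is an algebraically closed field of characteristic $0$; all spaces are over $\mathbb K$. $\Gamma$ is an abelian group and $\varepsilon:\Gamma\times\Gamma\to\mathbb K^*=\mathbb K\setminus\{0\}$ is a commutation factor: $\varepsilon(a,b)\varepsilon(b,a)=1$, $\varepsilon(a,b+c)=\varepsilon(a,b)\varepsilon(a,c)$, $\varepsilon(a+b,c)=\varepsilon(a,c)\varepsilon(b,c)$. For a $\Gamma$-graded linear space $V$, $\mathcal H(V)$ is the set of homogeneous elements; inside $\varepsilon$ a homogeneous element stands for its degree (so $\varepsilon(x+y,z)=\varepsilon(\deg x+\deg y,\deg z)$). A linear map is even if it preserves degrees; a bilinear multiplication on $A$ is even if $A_\gamma A_{\gamma'}\subseteq A_{\gamma+\gamma'}$. A color Hom-algebra $(A,\cdot,\varepsilon,\alpha)$ is a $\Gamma$-graded space $A$ with an even bilinear multiplication $\cdot$ and an even linear map $\alpha:A\to A$ (not assumed multiplicative). The tensor product is graded by $(A_1\otimes A_2)_\gamma=\bigoplus_{a+b=\gamma}(A_1)_a\otimes(A_2)_b$. All identities are for all homogeneous $x,y,z$. $\varepsilon$-commutative Hom-associative color Hom-algebra $(A,\cdot,\varepsilon,\alpha)$: a color Hom-algebra with $\alpha(x)\cdot(y\cdot z)=(x\cdot y)\cdot\alpha(z)$ and $x\cdot y=\varepsilon(x,y)y\cdot x$. Hom-Novikov color Hom-algebra $(A,\diamond,\varepsilon,\alpha)$: a color Hom-algebra with $(x\diamond y)\diamond\alpha(z)-\alpha(x)\diamond(y\diamond z)=\varepsilon(x,y)\big((y\diamond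 x)\diamond\alpha(z)-\alpha(y)\diamond(x\diamond z)\big)$ and $(x\diamond y)\diamond\alpha(z)=\varepsilon(y,z)(x\diamond z)\diamond\alpha(y)$. Hom-Novikov-Poisson color Hom-algebra $(A,\cdot,\diamond,\varepsilon,\alpha)$: $(A,\cdot,\varepsilon,\alpha)$ is $\varepsilon$-commutative Hom-associative, $(A,\diamond,\varepsilon,\alpha)$ is Hom-Novikov, and $(x\cdot y)\diamond\alpha(z)=\varepsilon(y,z)(x\diamond z)\cdot\alpha(y)$, $(x\diamond y)\cdot\alpha(z)-\alpha(x)\diamond(y\cdot z)=\varepsilon(x,y)\big((y\diamond x)\cdot\alpha(z)-\alpha(y)\diamond(x\cdot z)\big)$. Hom-Lie color Hom-algebra $(A,[\cdot,\cdot],\varepsilon,\alpha)$: $[\cdot,\cdot]$ even bilinear, $\alpha$ even linear, $[x,y]=-\varepsilon(x,y)[y,x]$ and $\circlearrowleft_{x,y,z}\varepsilon(z,x)[\alpha(x),[y,z]]=0$ (cyclic sum over $(x,y,z)$). Hom-Poisson color Hom-algebra $(A,\cdot,[\cdot,\cdot],\varepsilon,\alpha)$: $(A,\cdot,\varepsilon,\alpha)$ is $\varepsilon$-commutative Hom-associative, $(A,[\cdot,\cdot],\varepsilon,\alpha)$ is Hom-Lie, and $[\alpha(x),y\cdot z]=\varepsilon(x,y)\alpha(y)\cdot[x,z]+\varepsilon(x+y,z)\alpha(z)\cdot[x,y]$. A Hom-Novikov-Poisson color Hom-algebra $(A,\cdot,\diamond,\varepsilon,\alpha)$ is admissible if $(A,\cdot,[\cdot,\cdot],\varepsilon,\alpha)$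 with $[x,y]=x\diamond y-\varepsilon(x,y)y\diamond x$ is a Hom-Poisson color Hom-algebra. *)

theory Defs
  imports "HOL-Computational_Algebra.Polynomial" "HOL-Library.Poly_Mapping"
begin

section \<open>Color Hom-algebras\<close>

definition commutation_factor :: "('g::ab_group_add \<Rightarrow> 'g \<Rightarrow> 'k::field) \<Rightarrow> bool" where
  "commutation_factor \<epsilon> \<longleftrightarrow>
     (\<forall>a b. \<epsilon> a b \<noteq> 0) \<and>
     (\<forall>a b. \<epsilon> a b * \<epsilon> b a = 1) \<and>
     (\<forall>a b c. \<epsilon> a (b + c) = \<epsilon> a b * \<epsilon> a c) \<and>
     (\<forall>a b c. \<epsilon> (a + b) c = \<epsilon> a c * \<epsilon> b c)"

definition bilinear_map ::
  "('k::field \<Rightarrow> 'u::ab_group_add \<Rightarrow> 'u) \<Rightarrow> ('k \<Rightarrow> 'v::ab_group_add \<Rightarrow> 'v) \<Rightarrow>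
   ('k \<Rightarrow> 'w::ab_group_add \<Rightarrow> 'w) \<Rightarrow> ('u \<Rightarrow> 'v \<Rightarrow> 'w) \<Rightarrow> bool" where
  "bilinear_map s1 s2 s3 f \<longleftrightarrow>
     (\<forall>x. Vector_Spaces.linear s2 s3 (f x)) \<and> (\<forall>y. Vector_Spaces.linear s1 s3 (\<lambda>x. f x y))"

text \<open>
  The homogeneous elements of degree \<open>a\<close> are those of \<open>grade a\<close>.  Below, identities for
  homogeneous elements quantify over elements together with degrees, and \<open>\<epsilon>\<close> is applied to the
  degrees.  The element \<open>0\<close> lies in every component; this is harmless because each term
  of each identity vanishes when one of its arguments is \<open>0\<close>.
\<close>

locale graded_space = vector_space scale
  for scale :: "'k::field \<Rightarrow> 'v::ab_group_add \<Rightarrow> 'v" +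
  fixes grade :: "'g::ab_group_add \<Rightarrow> 'v set"
  assumes subspace_grade: "subspace (grade a)"
    and direct_sum:
      "\<exists>!c. (\<forall>a. c a \<in> grade a) \<and> finite {a. c a \<noteq> 0} \<and> v = (\<Sum>a | c a \<noteq> 0. c a)"

locale color_hom_algebra = graded_space scale grade
  for scale :: "'k::field \<Rightarrow> 'v::ab_group_add \<Rightarrow> 'v" and grade :: "'g::ab_group_add \<Rightarrow> 'v set" +
  fixes mul :: "'v \<Rightarrow> 'v \<Rightarrow> 'v" and \<epsilon> :: "'g \<Rightarrow> 'g \<Rightarrow> 'k" and \<alpha> :: "'v \<Rightarrow> 'v"
  assumes commutation_factor: "commutation_factor \<epsilon>"
    and bilinear_mul: "bilinear_map scale scale scale mul"
    and even_mul: "x \<in> grade a \<Longrightarrow> y \<in> grade b \<Longrightarrow> mul x y \<in> grade (a + b)"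
    and linear_twist: "Vector_Spaces.linear scale scale \<alpha>"
    and even_twist: "x \<in> grade a \<Longrightarrow> \<alpha> x \<in> grade a"

locale comm_hom_assoc_color = color_hom_algebra +
  assumes hom_assoc:
      "x \<in> grade a \<Longrightarrow> y \<in> grade b \<Longrightarrow> z \<in> grade c \<Longrightarrow>
        mul (\<alpha> x) (mul y z) = mul (mul x y) (\<alpha> z)"
    and eps_comm:
      "x \<in> grade a \<Longrightarrow> y \<in> grade b \<Longrightarrow> mul x y = scale (\<epsilon> a b) (mul y x)"

locale hom_novikov_color = color_hom_algebra scale grade dia \<epsilon> \<alpha>
  for scale :: "'k::field \<Rightarrow> 'v::ab_group_add \<Rightarrow> 'v" and grade :: "'g::ab_group_add \<Rightarrow> 'v set"
    and dia \<epsilon> \<alpha> +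
  assumes hom_left_symmetric:
      "x \<in> grade a \<Longrightarrow> y \<in> grade b \<Longrightarrow> z \<in> grade c \<Longrightarrow>
        dia (dia x y) (\<alpha> z) - dia (\<alpha> x) (dia y z) =
        scale (\<epsilon> a b) (dia (dia y x) (\<alpha> z) - dia (\<alpha> y) (dia x z))"
    and hom_right_comm:
      "x \<in> grade a \<Longrightarrow> y \<in> grade b \<Longrightarrow> z \<in> grade c \<Longrightarrow>
        dia (dia x y) (\<alpha> z) = scale (\<epsilon> b c) (dia (dia x z) (\<alpha> y))"

locale hom_novikov_poisson_color =
  com: comm_hom_assoc_color scale grade mul \<epsilon> \<alpha> +
  nov: hom_novikov_color scale grade dia \<epsilon> \<alpha>
  for scale :: "'k::field \<Rightarrow> 'v::ab_group_add \<Rightarrow> 'v" and grade :: "'g::ab_group_add \<Rightarrow> 'v set"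
    and mul dia \<epsilon> \<alpha> +
  assumes mul_dia:
      "x \<in> grade a \<Longrightarrow> y \<in> grade b \<Longrightarrow> z \<in> grade c \<Longrightarrow>
        dia (mul x y) (\<alpha> z) = scale (\<epsilon> b c) (mul (dia x z) (\<alpha> y))"
    and dia_mul:
      "x \<in> grade a \<Longrightarrow> y \<in> grade b \<Longrightarrow> z \<in> grade c \<Longrightarrow>
        mul (dia x y) (\<alpha> z) - dia (\<alpha> x) (mul y z) =
        scale (\<epsilon> a b) (mul (dia y x) (\<alpha> z) - dia (\<alpha> y) (mul x z))"

locale hom_lie_color = color_hom_algebra scale grade brk \<epsilon> \<alpha>
  for scale :: "'k::field \<Rightarrow> 'v::ab_group_add \<Rightarrow> 'v" and grade :: "'g::ab_group_add \<Rightarrow> 'v set"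
    and brk \<epsilon> \<alpha> +
  assumes eps_skew:
      "x \<in> grade a \<Longrightarrow> y \<in> grade b \<Longrightarrow> brk x y = - scale (\<epsilon> a b) (brk y x)"
    and hom_jacobi:
      "x \<in> grade a \<Longrightarrow> y \<in> grade b \<Longrightarrow> z \<in> grade c \<Longrightarrow>
        scale (\<epsilon> c a) (brk (\<alpha> x) (brk y z)) +
        scale (\<epsilon> a b) (brk (\<alpha> y) (brk z x)) +
        scale (\<epsilon> b c) (brk (\<alpha> z) (brk x y)) = 0"

locale hom_poisson_color =
  com: comm_hom_assoc_color scale grade mul \<epsilon> \<alpha> +
  lie: hom_lie_color scale grade brk \<epsilon> \<alpha>
  for scale :: "'k::field \<Rightarrow> 'v::ab_group_add \<Rightarrow> 'v" and grade :: "'g::ab_group_add \<Rightarrow> 'v set"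
    and mul brk \<epsilon> \<alpha> +
  assumes hom_leibniz:
      "x \<in> grade a \<Longrightarrow> y \<in> grade b \<Longrightarrow> z \<in> grade c \<Longrightarrow>
        brk (\<alpha> x) (mul y z) =
        scale (\<epsilon> a b) (mul (\<alpha> y) (brk x z)) + scale (\<epsilon> (a + b) c) (mul (\<alpha> z) (brk x y))"

text \<open>
  The formula \<open>[x,y] = x \<diamond> y - \<epsilon>(x,y) y \<diamond> x\<close> only makes sense for homogeneous \<open>x\<close> and \<open>y\<close>; the
  bracket is its bilinear extension.  Bilinearity is part of \<open>hom_poisson_color\<close>, and since
  homogeneous elements span, at most one \<open>brk\<close> qualifies below.
\<close>

locale admissible_hom_novikov_poisson_color =
  hom_novikov_poisson_color scale grade mul dia \<epsilon> \<alpha>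
  for scale :: "'k::field \<Rightarrow> 'v::ab_group_add \<Rightarrow> 'v" and grade :: "'g::ab_group_add \<Rightarrow> 'v set"
    and mul dia \<epsilon> \<alpha> +
  assumes admissible:
    "\<exists>brk. (\<forall>a b. \<forall>x\<in>grade a. \<forall>y\<in>grade b. brk x y = dia x y - scale (\<epsilon> a b) (dia y x)) \<and>
           hom_poisson_color scale grade mul brk \<epsilon> \<alpha>"


section \<open>Tensor products\<close>

text \<open>
  The tensor product \<open>V \<otimes> W\<close> is the free vector space on the set \<open>V \<times> W\<close> modulo the subspace
  generated by the bilinearity relations.  As this quotient depends on the two scalar
  multiplications it is not a type of its own; instead \<open>tensor_product\<close> says that a vector space
  with a map \<open>tens\<close> into it is this quotient, i.e. that the linear map from the free space
  determined by \<open>(v, w) \<mapsto> tens v w\<close> is onto and that its kernel is the subspace of relations.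
\<close>

definition free_scale :: "'k::field \<Rightarrow> ('i \<Rightarrow>\<^sub>0 'k) \<Rightarrow> ('i \<Rightarrow>\<^sub>0 'k)" where
  "free_scale c F = Poly_Mapping.map ((*) c) F"

definition free_extend ::
  "('k::field \<Rightarrow> 't::ab_group_add \<Rightarrow> 't) \<Rightarrow> ('i \<Rightarrow> 't) \<Rightarrow> ('i \<Rightarrow>\<^sub>0 'k) \<Rightarrow> 't" where
  "free_extend s f F = (\<Sum>i\<in>Poly_Mapping.keys F. s (Poly_Mapping.lookup F i) (f i))"

abbreviation gen :: "'i \<Rightarrow> ('i \<Rightarrow>\<^sub>0 'k::field)" where
  "gen i \<equiv> Poly_Mapping.single i 1"

definition tensor_relations ::
  "('k::field \<Rightarrow> 'v::ab_group_add \<Rightarrow> 'v) \<Rightarrow> ('k \<Rightarrow> 'w::ab_group_add \<Rightarrow> 'w) \<Rightarrow>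
   (('v \<times> 'w) \<Rightarrow>\<^sub>0 'k) set" where
  "tensor_relations s1 s2 =
     {gen (v + v', w) - gen (v, w) - gen (v', w) | v v' w. True} \<union>
     {gen (v, w + w') - gen (v, w) - gen (v, w') | v w w'. True} \<union>
     {gen (s1 c v, w) - free_scale c (gen (v, w)) | c v w. True} \<union>
     {gen (v, s2 c w) - free_scale c (gen (v, w)) | c v w. True}"

locale tensor_product = V: vector_space s1 + W: vector_space s2 + T: vector_space sT
  for s1 :: "'k::field \<Rightarrow> 'v::ab_group_add \<Rightarrow> 'v"
    and s2 :: "'k \<Rightarrow> 'w::ab_group_add \<Rightarrow> 'w"
    and sT :: "'k \<Rightarrow> 't::ab_group_add \<Rightarrow> 't" +
  fixes tens :: "'v \<Rightarrow> 'w \<Rightarrow> 't"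
  assumes onto: "surj (free_extend sT (\<lambda>(v, w). tens v w))"
    and kernel: "{F. free_extend sT (\<lambda>(v, w). tens v w) F = 0} =
                 module.span free_scale (tensor_relations s1 s2)"

definition tensor_grade ::
  "('k::field \<Rightarrow> 't::ab_group_add \<Rightarrow> 't) \<Rightarrow> ('v \<Rightarrow> 'w \<Rightarrow> 't) \<Rightarrow>
   ('g::ab_group_add \<Rightarrow> 'v set) \<Rightarrow> ('g \<Rightarrow> 'w set) \<Rightarrow> 'g \<Rightarrow> 't set" where
  "tensor_grade sT tens G1 G2 g =
     module.span sT {tens x y | x y a b. a + b = g \<and> x \<in> G1 a \<and> y \<in> G2 b}"


section \<open>Operations on the tensor product\<close>

definition is_tensor_twist ::
  "('k::field \<Rightarrow> 't::ab_group_add \<Rightarrow> 't) \<Rightarrow> ('v \<Rightarrow> 'w \<Rightarrow> 't) \<Rightarrow>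
   ('v \<Rightarrow> 'v) \<Rightarrow> ('w \<Rightarrow> 'w) \<Rightarrow> ('t \<Rightarrow> 't) \<Rightarrow> bool" where
  "is_tensor_twist sT tens \<alpha>1 \<alpha>2 \<alpha> \<longleftrightarrow>
     Vector_Spaces.linear sT sT \<alpha> \<and> (\<forall>x1 x2. \<alpha> (tens x1 x2) = tens (\<alpha>1 x1) (\<alpha>2 x2))"

definition is_tensor_mul ::
  "('k::field \<Rightarrow> 't::ab_group_add \<Rightarrow> 't) \<Rightarrow> ('v \<Rightarrow> 'w \<Rightarrow> 't) \<Rightarrow>
   ('g \<Rightarrow> 'v set) \<Rightarrow> ('g \<Rightarrow> 'w set) \<Rightarrow> ('g \<Rightarrow> 'g \<Rightarrow> 'k) \<Rightarrow>
   ('v \<Rightarrow> 'v \<Rightarrow> 'v) \<Rightarrow> ('w \<Rightarrow> 'w \<Rightarrow> 'w) \<Rightarrow> ('t \<Rightarrow> 't \<Rightarrow> 't) \<Rightarrow> bool" where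
  "is_tensor_mul sT tens G1 G2 \<epsilon> mul1 mul2 mul \<longleftrightarrow>
     bilinear_map sT sT sT mul \<and>
     (\<forall>a1 a2 b1 b2. \<forall>x1\<in>G1 a1. \<forall>x2\<in>G2 a2. \<forall>y1\<in>G1 b1. \<forall>y2\<in>G2 b2.
        mul (tens x1 x2) (tens y1 y2) = sT (\<epsilon> a2 b1) (tens (mul1 x1 y1) (mul2 x2 y2)))"

definition is_tensor_dia ::
  "('k::field \<Rightarrow> 't::ab_group_add \<Rightarrow> 't) \<Rightarrow> ('v \<Rightarrow> 'w \<Rightarrow> 't) \<Rightarrow>
   ('g \<Rightarrow> 'v set) \<Rightarrow> ('g \<Rightarrow> 'w set) \<Rightarrow> ('g \<Rightarrow> 'g \<Rightarrow> 'k) \<Rightarrow>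
   ('v \<Rightarrow> 'v \<Rightarrow> 'v) \<Rightarrow> ('v \<Rightarrow> 'v \<Rightarrow> 'v) \<Rightarrow> ('w \<Rightarrow> 'w \<Rightarrow> 'w) \<Rightarrow> ('w \<Rightarrow> 'w \<Rightarrow> 'w) \<Rightarrow>
   ('t \<Rightarrow> 't \<Rightarrow> 't) \<Rightarrow> bool" where
  "is_tensor_dia sT tens G1 G2 \<epsilon> mul1 dia1 mul2 dia2 dia \<longleftrightarrow>
     bilinear_map sT sT sT dia \<and>
     (\<forall>a1 a2 b1 b2. \<forall>x1\<in>G1 a1. \<forall>x2\<in>G2 a2. \<forall>y1\<in>G1 b1. \<forall>y2\<in>G2 b2.
        dia (tens x1 x2) (tens y1 y2) =
        sT (\<epsilon> a2 b1) (tens (dia1 x1 y1) (mul2 x2 y2) + tens (mul1 x1 y1) (dia2 x2 y2)))"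


section \<open>Adequacy of the definition of tensor products\<close>

text \<open>
  That \<open>tensor_product\<close> describes the tensor product is confirmed by two facts: the universal property \<open>tensor_product_universal\<close>, and the existence of a model \<open>tensor_product_free\<close> for arbitrary free, hence up to
  isomorphism for arbitrary, vector spaces.
\<close>

lemma lookup_free_scale [simp]:
  "Poly_Mapping.lookup (free_scale c F) i = c * Poly_Mapping.lookup F i"
  by (simp add: free_scale_def Poly_Mapping.map.rep_eq when_def)

lemma vector_space_free_scale: "vector_space free_scale"
  by unfold_locales (auto intro!: poly_mapping_eqI simp: lookup_add algebra_simps)

lemma free_extend_superset:
  assumes "vector_space s" "finite S" "Poly_Mapping.keys F \<subseteq> S"
  shows "free_extend s f F = (\<Sum>i\<in>S. s (Poly_Mapping.lookup F i) (f i))"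
proof -
  interpret vector_space s by fact
  show ?thesis unfolding free_extend_def
    using assms(2,3) by (intro sum.mono_neutral_left) (auto simp: in_keys_iff)
qed

lemma linear_mapI:
  assumes "vector_space s" "vector_space s'"
    and "\<And>x y. f (x + y) = f x + f y" "\<And>c x. f (s c x) = s' c (f x)"
  shows "Vector_Spaces.linear s s' f"
  using assms by (simp add: Vector_Spaces.linear_iff)

lemma linear_free_extend:
  fixes s :: "'k::field \<Rightarrow> 't::ab_group_add \<Rightarrow> 't" and f :: "'i \<Rightarrow> 't"
  assumes "vector_space s"
  shows "Vector_Spaces.linear free_scale s (free_extend s f)"
proof -
  interpret F: vector_space free_scale by (rule vector_space_free_scale)
  interpret vector_space s by fact
  show ?thesis
  proof (rule linear_mapI[OF F.vector_space_axioms assms])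
    fix F G :: "'i \<Rightarrow>\<^sub>0 'k"
    let ?S = "Poly_Mapping.keys F \<union> Poly_Mapping.keys G"
    have "Poly_Mapping.keys (F + G) \<subseteq> ?S" by (rule keys_add)
    then show "free_extend s f (F + G) = free_extend s f F + free_extend s f G"
      by (simp add: free_extend_superset[OF assms, of ?S] lookup_add scale_left_distrib sum.distrib)
  next
    fix c and F :: "'i \<Rightarrow>\<^sub>0 'k"
    have "Poly_Mapping.keys (free_scale c F) \<subseteq> Poly_Mapping.keys F" by (auto simp: in_keys_iff)
    then show "free_extend s f (free_scale c F) = s c (free_extend s f F)"
      by (simp add: free_extend_superset[OF assms, of "Poly_Mapping.keys F"] scale_sum_right)
  qed
qed

lemma free_extend_gen:
  assumes "vector_space s"
  shows "free_extend s f (gen i) = f i"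
proof -
  interpret vector_space s by fact
  show ?thesis by (simp add: free_extend_def)
qed

lemma free_extend_relations:
  assumes f: "bilinear_map s1 s2 sU f" and U: "vector_space sU"
    and F: "F \<in> module.span free_scale (tensor_relations s1 s2)"
  shows "free_extend sU (\<lambda>(v, w). f v w) F = 0"
proof -
  interpret F: vector_space free_scale by (rule vector_space_free_scale)
  interpret U: vector_space sU by fact
  interpret Vector_Spaces.linear free_scale sU "free_extend sU (\<lambda>(v, w). f v w)"
    by (rule linear_free_extend) fact
  have l: "Vector_Spaces.linear s2 sU (f x)" and r: "Vector_Spaces.linear s1 sU (\<lambda>x. f x y)" for x y
    using f by (auto simp: bilinear_map_def)
  note R = module_hom.add[OF Vector_Spaces.linear.axioms(3)[OF l]] module_hom.add[OF Vector_Spaces.linear.axioms(3)[OF r]]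
    module_hom.scale[OF Vector_Spaces.linear.axioms(3)[OF l]] module_hom.scale[OF Vector_Spaces.linear.axioms(3)[OF r]]
    free_extend_gen[OF U]
  show ?thesis
  proof (rule F.span_induct[OF F])
    show "F.subspace {F. free_extend sU (\<lambda>(v, w). f v w) F = 0}"
      by (auto intro!: F.subspaceI simp: add scale zero)
    show "free_extend sU (\<lambda>(v, w). f v w) G = 0" if "G \<in> tensor_relations s1 s2" for G
      using that unfolding tensor_relations_def
      by (elim UnE CollectE exE) (simp_all add: diff scale R)
  qed
qed

context tensor_product
begin

lemma tens_gen: "free_extend sT (\<lambda>(v, w). tens v w) (gen (v, w)) = tens v w"
  by (simp add: free_extend_gen T.vector_space_axioms)

lemma tens_bilinear: "bilinear_map s1 s2 sT tens"
proof -
  interpret F: vector_space free_scale by (rule vector_space_free_scale)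
  interpret E: Vector_Spaces.linear free_scale sT "free_extend sT (\<lambda>(v, w). tens v w)"
    by (rule linear_free_extend) (rule T.vector_space_axioms)
  have R: "free_extend sT (\<lambda>(v, w). tens v w) F = 0" if "F \<in> tensor_relations s1 s2" for F
    using kernel F.span_base[OF that] by blast
  have a1: "tens (v + v') w = tens v w + tens v' w" for v v' w
  proof -
    have "gen (v + v', w) - gen (v, w) - gen (v', w) \<in> tensor_relations s1 s2"
      unfolding tensor_relations_def by blast
    from R[OF this] show ?thesis by (simp add: E.diff E.add E.scale tens_gen diff_diff_eq)
  qed
  have a2: "tens v (w + w') = tens v w + tens v w'" for v w w'
  proof -
    have "gen (v, w + w') - gen (v, w) - gen (v, w') \<in> tensor_relations s1 s2"
      unfolding tensor_relations_def by blast
    from R[OF this] show ?thesis by (simp add: E.diff E.add E.scale tens_gen diff_diff_eq)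
  qed
  have c1: "tens (s1 c v) w = sT c (tens v w)" for c v w
  proof -
    have "gen (s1 c v, w) - free_scale c (gen (v, w)) \<in> tensor_relations s1 s2"
      unfolding tensor_relations_def by blast
    from R[OF this] show ?thesis by (simp add: E.diff E.add E.scale tens_gen diff_diff_eq)
  qed
  have c2: "tens v (s2 c w) = sT c (tens v w)" for c v w
  proof -
    have "gen (v, s2 c w) - free_scale c (gen (v, w)) \<in> tensor_relations s1 s2"
      unfolding tensor_relations_def by blast
    from R[OF this] show ?thesis by (simp add: E.diff E.add E.scale tens_gen diff_diff_eq)
  qed
  show ?thesis
    unfolding bilinear_map_def by (auto intro!: linear_mapI V.vector_space_axioms
      W.vector_space_axioms T.vector_space_axioms simp: a1 a2 c1 c2)
qed

theorem tensor_product_universal: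
  assumes U: "vector_space sU" and f: "bilinear_map s1 s2 sU f"
  shows "\<exists>!h. Vector_Spaces.linear sT sU h \<and> (\<forall>v w. h (tens v w) = f v w)"
proof -
  let ?E = "free_extend sT (\<lambda>(v, w). tens v w)" and ?f = "free_extend sU (\<lambda>(v, w). f v w)"
  interpret F: vector_space free_scale by (rule vector_space_free_scale)
  interpret U: vector_space sU by fact
  interpret E: Vector_Spaces.linear free_scale sT ?E
    by (rule linear_free_extend) (rule T.vector_space_axioms)
  interpret f: Vector_Spaces.linear free_scale sU ?f by (rule linear_free_extend) fact
  define h where "h = (\<lambda>t. ?f (SOME F. ?E F = t))"
  have h: "h (?E F) = ?f F" for F
  proof -
    have *: "?E (SOME G. ?E G = ?E F) = ?E F" by (rule someI) rule
    have "?E ((SOME G. ?E G = ?E F) - F) = 0" by (simp only: E.diff *) simp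
    then have "?f ((SOME G. ?E G = ?E F) - F) = 0"
      using kernel free_extend_relations[OF f U] by blast
    then show ?thesis by (simp add: h_def f.diff)
  qed
  have lin: "Vector_Spaces.linear sT sU h"
  proof (rule linear_mapI[OF T.vector_space_axioms U])
    fix s t obtain F G where "s = ?E F" "t = ?E G" using onto by (metis surjD)
    then show "h (s + t) = h s + h t" using h[of "F + G"] h[of F] h[of G] by (simp add: E.add f.add)
  next
    fix c t obtain F where "t = ?E F" using onto by (metis surjD)
    then show "h (sT c t) = sU c (h t)" using h[of "free_scale c F"] h[of F]
      by (simp add: E.scale f.scale)
  qed
  have val: "h (tens v w) = f v w" for v w
    using h[of "gen (v, w)"] by (simp add: tens_gen free_extend_gen[OF U])
  show ?thesis
  proof (rule ex1I[of _ h])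
    fix k assume k: "Vector_Spaces.linear sT sU k \<and> (\<forall>v w. k (tens v w) = f v w)"
    then interpret k: Vector_Spaces.linear sT sU k by simp
    have "k (?E F) = ?f F" for F
      using k by (simp add: free_extend_def k.sum k.scale case_prod_unfold)
    then show "k = h" using h onto by (metis ext surjD)
  qed (use lin val in auto)
qed

end

definition free_tens :: "('i \<Rightarrow>\<^sub>0 'k::field) \<Rightarrow> ('j \<Rightarrow>\<^sub>0 'k) \<Rightarrow> (('i \<times> 'j) \<Rightarrow>\<^sub>0 'k)" where
  "free_tens v w =
     (\<Sum>i\<in>Poly_Mapping.keys v. \<Sum>j\<in>Poly_Mapping.keys w.
        Poly_Mapping.single (i, j) (Poly_Mapping.lookup v i * Poly_Mapping.lookup w j))"

lemma lookup_free_tens [simp]: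
  "Poly_Mapping.lookup (free_tens v w) (i, j) = Poly_Mapping.lookup v i * Poly_Mapping.lookup w j"
proof -
  have "Poly_Mapping.lookup (free_tens v w) (i, j) =
     (\<Sum>i'\<in>Poly_Mapping.keys v. \<Sum>j'\<in>Poly_Mapping.keys w.
        (if i' = i then if j' = j then Poly_Mapping.lookup v i * Poly_Mapping.lookup w j else 0 else 0))"
    unfolding free_tens_def lookup_sum
    by (intro sum.cong refl) (auto simp: lookup_single when_def)
  also have "\<dots> = (\<Sum>i'\<in>Poly_Mapping.keys v. if i' = i then
        (\<Sum>j'\<in>Poly_Mapping.keys w. if j' = j then Poly_Mapping.lookup v i * Poly_Mapping.lookup w j else 0) else 0)"
    by (intro sum.cong refl) simp
  also have "\<dots> = Poly_Mapping.lookup v i * Poly_Mapping.lookup w j"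
    by (simp add: in_keys_iff)
  finally show ?thesis .
qed

lemma bilinear_free_tens: "bilinear_map free_scale free_scale free_scale free_tens"
  unfolding bilinear_map_def
  by (intro conjI allI linear_mapI vector_space_free_scale poly_mapping_eqI)
    (auto simp: lookup_add algebra_simps)

lemma free_extend_id: "free_extend free_scale gen F = F"
  by (rule poly_mapping_eqI)
    (auto simp: free_extend_def lookup_sum lookup_single when_def in_keys_iff if_distrib cong: if_cong)

lemma tensor_product_free:
  "tensor_product free_scale free_scale free_scale
     (free_tens :: ('i \<Rightarrow>\<^sub>0 'k::field) \<Rightarrow> ('j \<Rightarrow>\<^sub>0 'k) \<Rightarrow> _)"
proof -
  let ?tens = "free_tens :: ('i \<Rightarrow>\<^sub>0 'k) \<Rightarrow> ('j \<Rightarrow>\<^sub>0 'k) \<Rightarrow> _"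
  let ?R = "tensor_relations free_scale free_scale :: ((('i \<Rightarrow>\<^sub>0 'k) \<times> ('j \<Rightarrow>\<^sub>0 'k)) \<Rightarrow>\<^sub>0 'k) set"
  let ?E = "free_extend free_scale (\<lambda>(v, w). ?tens v w)"
  interpret F: vector_space "free_scale :: 'k \<Rightarrow> ('i \<Rightarrow>\<^sub>0 'k) \<Rightarrow> _" by (rule vector_space_free_scale)
  interpret G: vector_space "free_scale :: 'k \<Rightarrow> ('j \<Rightarrow>\<^sub>0 'k) \<Rightarrow> _" by (rule vector_space_free_scale)
  interpret FG: vector_space "free_scale :: 'k \<Rightarrow> (('i \<times> 'j) \<Rightarrow>\<^sub>0 'k) \<Rightarrow> _"
    by (rule vector_space_free_scale)
  interpret P: vector_space "free_scale :: 'k \<Rightarrow> ((('i \<Rightarrow>\<^sub>0 'k) \<times> ('j \<Rightarrow>\<^sub>0 'k)) \<Rightarrow>\<^sub>0 'k) \<Rightarrow> _"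
    by (rule vector_space_free_scale)
  interpret E: Vector_Spaces.linear free_scale free_scale ?E
    by (rule linear_free_extend) (rule vector_space_free_scale)
  define \<theta> :: "(('i \<times> 'j) \<Rightarrow>\<^sub>0 'k) \<Rightarrow> ((('i \<Rightarrow>\<^sub>0 'k) \<times> ('j \<Rightarrow>\<^sub>0 'k)) \<Rightarrow>\<^sub>0 'k)"
    where "\<theta> = free_extend free_scale (\<lambda>(i, j). gen (gen i, gen j))"
  interpret \<theta>: Vector_Spaces.linear free_scale free_scale \<theta>
    unfolding \<theta>_def by (rule linear_free_extend) (rule vector_space_free_scale)
  have gen: "?tens (gen i) (gen j) = gen (i, j)" for i j
    by (simp add: free_tens_def)
  have E\<theta>: "?E (\<theta> t) = t" for t
  proof -
    have "?E (\<theta> t) = (\<Sum>p\<in>Poly_Mapping.keys t. free_scale (Poly_Mapping.lookup t p) (?E (case p of (i, j) \<Rightarrow> gen (gen i, gen j))))"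
      unfolding \<theta>_def free_extend_def[of _ "\<lambda>(i, j). gen (gen i, gen j)"] E.sum E.scale ..
    also have "\<dots> = free_extend free_scale gen t"
      unfolding free_extend_def[of _ gen]
      by (intro sum.cong refl) (auto simp: free_extend_gen[OF FG.vector_space_axioms] gen)
    finally have "?E (\<theta> t) = free_extend free_scale gen t" .
    then show ?thesis by (simp add: free_extend_id)
  qed
  let ?N = "P.span ?R"
  define cong where "cong A B \<longleftrightarrow> A - B \<in> ?N" for A B
  have cong_refl: "cong A A" for A by (simp add: cong_def P.span_zero)
  have cong_sym: "cong B A" if "cong A B" for A B
    using P.span_neg[OF that[unfolded cong_def]] by (simp add: cong_def)
  have cong_trans [trans]: "cong A C" if "cong A B" "cong B C" for A B C
    using P.span_add[OF that[unfolded cong_def]] by (simp add: cong_def)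
  have cong_add: "cong (A + C) (B + D)" if "cong A B" "cong C D" for A B C D
    using P.span_add[OF that[unfolded cong_def]] by (simp add: cong_def algebra_simps)
  have cong_scale: "cong (free_scale c A) (free_scale c B)" if "cong A B" for c A B
    using P.span_scale[OF that[unfolded cong_def], of c] by (simp add: cong_def P.scale_right_diff_distrib)
  have cong_sum: "cong (sum f S) (sum g S)" if "\<And>i. i \<in> S \<Longrightarrow> cong (f i) (g i)"
    for S :: "'z set" and f g
    using that by (induction S rule: infinite_finite_induct) (auto intro: cong_refl cong_add)
  have a1: "cong (gen (v + v', w)) (gen (v, w) + gen (v', w))" for v v' w
    unfolding cong_def diff_diff_eq[symmetric]
    by (rule P.span_base) (unfold tensor_relations_def, blast)
  have a2: "cong (gen (v, w + w')) (gen (v, w) + gen (v, w'))" for v w w'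
    unfolding cong_def diff_diff_eq[symmetric]
    by (rule P.span_base) (unfold tensor_relations_def, blast)
  have c1: "cong (gen (free_scale c v, w)) (free_scale c (gen (v, w)))" for c v w
    unfolding cong_def by (rule P.span_base) (unfold tensor_relations_def, blast)
  have c2: "cong (gen (v, free_scale c w)) (free_scale c (gen (v, w)))" for c v w
    unfolding cong_def by (rule P.span_base) (unfold tensor_relations_def, blast)
  have z1: "cong (gen (0, w)) 0" and z2: "cong (gen (v, 0)) 0" for v w
    using c1[of 0 0 w] c2[of v 0 0] by simp_all
  have s1: "cong (gen (sum f S, w)) (\<Sum>i\<in>S. gen (f i, w))" for f w and S :: "'i set"
    by (induction S rule: infinite_finite_induct)
      (auto intro: z1 cong_trans[OF a1] cong_add cong_refl)
  have s2: "cong (gen (v, sum f S)) (\<Sum>j\<in>S. gen (v, f j))" for f v and S :: "'j set"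
    by (induction S rule: infinite_finite_induct)
      (auto intro: z2 cong_trans[OF a2] cong_add cong_refl)
  have l: "\<theta> (?tens v w) = (\<Sum>i\<in>Poly_Mapping.keys v. \<Sum>j\<in>Poly_Mapping.keys w.
      free_scale (Poly_Mapping.lookup v i) (free_scale (Poly_Mapping.lookup w j) (gen (gen i, gen j))))" for v w
  proof -
    have "Poly_Mapping.single (i, j) (a * b) = free_scale a (free_scale b (gen (i, j)))"
      for i :: 'i and j :: 'j and a b :: 'k
      by (rule poly_mapping_eqI) (simp add: lookup_single when_def)
    moreover have "\<theta> (gen (i, j)) = gen (gen i, gen j)" for i j
      by (simp add: \<theta>_def free_extend_gen[OF P.vector_space_axioms])
    ultimately show ?thesis by (simp add: free_tens_def \<theta>.sum \<theta>.scale)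
  qed
  have key: "cong (gen (v, w)) (\<theta> (?tens v w))" for v w
  proof -
    have "cong (gen (v, w)) (gen (\<Sum>i\<in>Poly_Mapping.keys v. free_scale (Poly_Mapping.lookup v i) (gen i), w))"
      using free_extend_id[of v] by (simp add: free_extend_def cong_refl)
    also have "cong \<dots> (\<Sum>i\<in>Poly_Mapping.keys v. gen (free_scale (Poly_Mapping.lookup v i) (gen i), w))"
      by (rule s1)
    also have "cong \<dots> (\<Sum>i\<in>Poly_Mapping.keys v. \<Sum>j\<in>Poly_Mapping.keys w.
      free_scale (Poly_Mapping.lookup v i) (free_scale (Poly_Mapping.lookup w j) (gen (gen i, gen j))))"
    proof (rule cong_sum)
      fix i
      have "cong (gen (gen i, w)) (gen (gen i, \<Sum>j\<in>Poly_Mapping.keys w. free_scale (Poly_Mapping.lookup w j) (gen j)))"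
        using free_extend_id[of w] by (simp add: free_extend_def cong_refl)
      also have "cong \<dots> (\<Sum>j\<in>Poly_Mapping.keys w. gen (gen i, free_scale (Poly_Mapping.lookup w j) (gen j)))"
        by (rule s2)
      also have "cong \<dots> (\<Sum>j\<in>Poly_Mapping.keys w. free_scale (Poly_Mapping.lookup w j) (gen (gen i, gen j)))"
        by (rule cong_sum) (rule c2)
      finally show "cong (gen (free_scale (Poly_Mapping.lookup v i) (gen i), w)) (\<Sum>j\<in>Poly_Mapping.keys w.
        free_scale (Poly_Mapping.lookup v i) (free_scale (Poly_Mapping.lookup w j) (gen (gen i, gen j))))"
        unfolding P.scale_sum_right[symmetric] by (rule cong_trans[OF c1 cong_scale])
    qed
    finally show ?thesis unfolding l .
  qed
  have "cong A (\<theta> (?E A))" for A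
  proof -
    have "cong (free_extend free_scale gen A) (\<theta> (?E A))"
      unfolding free_extend_def \<theta>.sum \<theta>.scale
      by (rule cong_sum) (auto intro: cong_scale key)
    then show ?thesis by (simp only: free_extend_id)
  qed
  then have ker: "A \<in> ?N" if "?E A = 0" for A
    using that by (metis cong_def diff_zero \<theta>.zero)
  show ?thesis
  proof unfold_locales
    show "surj ?E" using E\<theta> by (metis surjI)
    show "{A. ?E A = 0} = ?N"
      using ker free_extend_relations[OF bilinear_free_tens FG.vector_space_axioms] by blast
  qed
qed

end

theory Submission
  imports Defs
begin

text \<open>
  Write \<open>f(x,y,z) = (x \<diamond> y) \<cdot> \<alpha>(z)\<close> and \<open>g(x,y,z) = (x \<cdot> y) \<cdot> \<alpha>(z)\<close>.  A Hom-Novikov-Poisson color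
  Hom-algebra is admissible if and only if \<open>f\<close> is \<open>\<epsilon>\<close>-symmetric in its first two arguments and
  \<open>\<alpha>(x) \<diamond> (y \<cdot> z) = f(x,y,z)\<close>; then \<open>f\<close> is \<open>\<epsilon>\<close>-symmetric in all three arguments, and all three
  terms of the Hom-Leibniz identity vanish.  In an admissible algebra also \<open>(x \<cdot> y) \<diamond> \<alpha>(z)\<close> and
  \<open>\<alpha>(x) \<cdot> (y \<diamond> z)\<close> equal \<open>f(x,y,z)\<close>.  Hence on the tensor product every product of three elements
  involving one \<open>\<diamond>\<close> is \<open>f\<^sub>1 \<otimes> g\<^sub>2 + g\<^sub>1 \<otimes> f\<^sub>2\<close> up to one common sign, while
  \<open>(x \<diamond> y) \<diamond> \<alpha>(z)\<close> and \<open>\<alpha>(x) \<diamond> (y \<diamond> z)\<close> have the same mixed term \<open>2 f\<^sub>1 \<otimes> f\<^sub>2\<close>, which is symmetric.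
  The Novikov identities thus reduce to those of the two factors.
\<close>

section \<open>Multilinear maps and graded spaces\<close>

lemma linearD:
  assumes "Vector_Spaces.linear s s' f"
  shows "f (x + y) = f x + f y"
    "f (s c x) = s' c (f x)"
    "f 0 = 0"
    "f (x - y) = f x - f y"
    "f (- x) = - f x"
    "f (sum g S) = (\<Sum>i\<in>S. f (g i))"
proof -
  interpret Vector_Spaces.linear s s' f by fact
  show "f (x + y) = f x + f y" "f (s c x) = s' c (f x)" "f 0 = 0" "f (x - y) = f x - f y"
    "f (- x) = - f x" "f (sum g S) = (\<Sum>i\<in>S. f (g i))"
    by (simp_all add: add scale diff neg sum)
qed

lemma bilinear_mapD:
  assumes "bilinear_map s1 s2 s3 f"
  shows "Vector_Spaces.linear s2 s3 (f x)" "Vector_Spaces.linear s1 s3 (\<lambda>x. f x y)"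
  using assms by (auto simp: bilinear_map_def)

lemma bilinear_map_simps:
  assumes "bilinear_map s1 s2 s3 f"
  shows "f x (y + y') = f x y + f x y'" "f (x + x') y = f x y + f x' y"
    "f x (y - y') = f x y - f x y'" "f (x - x') y = f x y - f x' y"
    "f x (s2 c y) = s3 c (f x y)" "f (s1 c x) y = s3 c (f x y)"
    "f x 0 = 0" "f 0 y = 0"
  using linearD[OF bilinear_mapD(1)[OF assms, of x]] linearD[OF bilinear_mapD(2)[OF assms, of y]]
  by (simp_all del: add_uminus_conv_diff)

lemma
  assumes "Vector_Spaces.linear s s' f" "Vector_Spaces.linear s s' g"
  shows linear_map_add: "Vector_Spaces.linear s s' (\<lambda>x. f x + g x)"
    and linear_map_diff: "Vector_Spaces.linear s s' (\<lambda>x. f x - g x)"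
proof -
  interpret vector_space s' using assms(1) by (simp add: Vector_Spaces.linear_iff)
  show "Vector_Spaces.linear s s' (\<lambda>x. f x + g x)" "Vector_Spaces.linear s s' (\<lambda>x. f x - g x)"
    using assms by (simp_all add: Vector_Spaces.linear_iff scale_right_distrib scale_right_diff_distrib)
qed

lemma linear_map_scale:
  assumes "Vector_Spaces.linear s s' f"
  shows "Vector_Spaces.linear s s' (\<lambda>x. s' c (f x))"
proof -
  interpret vector_space s' using assms(1) by (simp add: Vector_Spaces.linear_iff)
  show ?thesis
    using assms by (simp add: Vector_Spaces.linear_iff scale_right_distrib mult.commute)
qed

lemma linear_map_sum:
  assumes "vector_space s" "vector_space s'" "\<And>i. Vector_Spaces.linear s s' (f i)"
  shows "Vector_Spaces.linear s s' (\<lambda>x. \<Sum>i\<in>S. f i x)"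
proof -
  interpret vector_space s' by fact
  show ?thesis
    using assms by (simp add: Vector_Spaces.linear_iff sum.distrib scale_sum_right)
qed

lemma linear_map_compose:
  assumes "Vector_Spaces.linear s s' f" "Vector_Spaces.linear s' s'' g"
  shows "Vector_Spaces.linear s s'' (\<lambda>x. g (f x))"
  using assms by (simp add: Vector_Spaces.linear_iff)

lemma linear_zero_on_span:
  assumes "Vector_Spaces.linear s s' f" "x \<in> module.span s B" "\<And>b. b \<in> B \<Longrightarrow> f b = 0"
  shows "f x = 0"
proof -
  interpret Vector_Spaces.linear s s' f by fact
  show ?thesis using eq_0_on_span assms by blast
qed

section \<open>Homogeneous components and maps prescribed degree by degree\<close>

context graded_space
begin

definition component :: "'v \<Rightarrow> 'g \<Rightarrow> 'v" where
  "component v =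
     (THE c. (\<forall>a. c a \<in> grade a) \<and> finite {a. c a \<noteq> 0} \<and> v = (\<Sum>a | c a \<noteq> 0. c a))"

lemma component_props:
  "component v a \<in> grade a" "finite {a. component v a \<noteq> 0}"
  "(\<Sum>a | component v a \<noteq> 0. component v a) = v"
  using theI'[OF direct_sum[of v], folded component_def] by simp_all

text \<open>Any finite \<open>S\<close> containing the support will do, so a candidate decomposition
  can be checked without computing its exact support.\<close>

lemma component_unique:
  assumes "\<And>a. c a \<in> grade a" "finite S" "\<And>a. a \<notin> S \<Longrightarrow> c a = 0" "v = (\<Sum>a\<in>S. c a)"
  shows "component v = c"
  unfolding component_def
proof (rule the1_equality[OF direct_sum], intro conjI allI)
  show "c a \<in> grade a" for a by fact
  show "finite {a. c a \<noteq> 0}" using assms(2,3) by (rule_tac finite_subset[of _ S]) auto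
  show "v = (\<Sum>a | c a \<noteq> 0. c a)"
    unfolding assms(4) using assms(2,3) by (intro sum.mono_neutral_right) auto
qed

lemma grade_zero: "0 \<in> grade a"
  and grade_add: "x \<in> grade a \<Longrightarrow> y \<in> grade a \<Longrightarrow> x + y \<in> grade a"
  and grade_scale: "x \<in> grade a \<Longrightarrow> scale c x \<in> grade a"
  and grade_diff: "x \<in> grade a \<Longrightarrow> y \<in> grade a \<Longrightarrow> x - y \<in> grade a"
  using subspace_grade[of a] by (auto intro: subspace_0 subspace_add subspace_scale subspace_diff)

lemma component_sum:
  assumes "finite S" "{a. component v a \<noteq> 0} \<subseteq> S"
  shows "(\<Sum>a\<in>S. component v a) = v"
  using sum.mono_neutral_left[OF assms, of "component v"] component_props(3)[of v] by auto

text \<open>Cancellation may shrink the support, so both decompositions are added over the union of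
  their supports.\<close>

lemma component_add: "component (v + w) = (\<lambda>a. component v a + component w a)"
proof (rule component_unique)
  let ?S = "{a. component v a \<noteq> 0} \<union> {a. component w a \<noteq> 0}"
  show fin: "finite ?S" by (simp add: component_props)
  show "v + w = (\<Sum>a\<in>?S. component v a + component w a)"
    by (simp only: sum.distrib component_sum[OF fin Un_upper1] component_sum[OF fin Un_upper2])
qed (auto simp: component_props grade_add)

lemma component_scale: "component (scale c v) = (\<lambda>a. scale c (component v a))"
proof (rule component_unique)
  show "scale c v = (\<Sum>a | component v a \<noteq> 0. scale c (component v a))"
    by (simp add: scale_sum_right[symmetric] component_props)
qed (auto simp: component_props grade_scale)

lemma linear_component: "Vector_Spaces.linear scale scale (\<lambda>v. component v a)"
  by (rule linear_mapI) (simp_all add: component_add component_scale vector_space_axioms)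

lemma component_homogeneous:
  assumes "v \<in> grade a"
  shows "component v b = (if b = a then v else 0)"
proof -
  have "component v = (\<lambda>b. if b = a then v else 0)"
    by (rule component_unique[of _ "{a}"]) (use assms grade_zero in auto)
  then show ?thesis by simp
qed

text \<open>Glues maps \<open>\<phi> a\<close>, one for each degree, into one map on the whole
  space. It gives meaning to formulas whose signs depend on degrees.\<close>

definition graded_extend :: "('g \<Rightarrow> 'v \<Rightarrow> 'u::ab_group_add) \<Rightarrow> 'v \<Rightarrow> 'u" where
  "graded_extend \<phi> v = (\<Sum>a | component v a \<noteq> 0. \<phi> a (component v a))"

lemma graded_extend_superset:
  assumes "\<And>a. \<phi> a 0 = 0" "finite S" "{a. component v a \<noteq> 0} \<subseteq> S"
  shows "graded_extend \<phi> v = (\<Sum>a\<in>S. \<phi> a (component v a))"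
  unfolding graded_extend_def using assms by (intro sum.mono_neutral_left) auto

lemma graded_extend_homogeneous:
  assumes "v \<in> grade a" "\<And>a. \<phi> a 0 = 0"
  shows "graded_extend \<phi> v = \<phi> a v"
  using assms
  by (subst graded_extend_superset[of _ "{a}"]) (auto simp: component_homogeneous split: if_splits)

lemma linear_graded_extend:
  assumes "vector_space sU" "\<And>a. Vector_Spaces.linear scale sU (\<phi> a)"
  shows "Vector_Spaces.linear scale sU (graded_extend \<phi>)"
proof (rule linear_mapI[OF vector_space_axioms assms(1)])
  interpret U: vector_space sU by fact
  note L = linearD[OF assms(2)]
  note ext = graded_extend_superset[where \<phi> = \<phi>, OF L(3)]
  fix v w c
  let ?S = "{a. component v a \<noteq> 0} \<union> {a. component w a \<noteq> 0}"
  have fin: "finite ?S" by (simp add: component_props)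
  have sub: "{a. component (v + w) a \<noteq> 0} \<subseteq> ?S" by (auto simp: component_add)
  show "graded_extend \<phi> (v + w) = graded_extend \<phi> v + graded_extend \<phi> w"
    by (simp only: ext[OF fin sub] ext[OF fin Un_upper1] ext[OF fin Un_upper2])
      (simp add: component_add L(1) sum.distrib)
  have sub: "{a. component (scale c v) a \<noteq> 0} \<subseteq> {a. component v a \<noteq> 0}"
    by (auto simp: component_scale)
  show "graded_extend \<phi> (scale c v) = sU c (graded_extend \<phi> v)"
    by (simp only: ext[OF component_props(2) sub] ext[OF component_props(2)[of v] subset_refl])
      (simp add: component_scale L(2) U.scale_sum_right)
qed

text \<open>With \<open>v\<close> fixed, the index set of the sum does not depend on the variable
  \<open>u\<close>.\<close>

lemma linear_graded_extend_parameter: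
  assumes "vector_space s" "vector_space sU" "\<And>a v. Vector_Spaces.linear s sU (\<lambda>u. \<phi> u a v)"
  shows "Vector_Spaces.linear s sU (\<lambda>u. graded_extend (\<phi> u) v)"
  unfolding graded_extend_def using assms by (rule linear_map_sum)

lemma linear_eq_on_grades:
  assumes "Vector_Spaces.linear scale sU f" "Vector_Spaces.linear scale sU g"
    and "\<And>a v. v \<in> grade a \<Longrightarrow> f v = g v"
  shows "f v = g v"
proof -
  have "f (\<Sum>a | component v a \<noteq> 0. component v a) = g (\<Sum>a | component v a \<noteq> 0. component v a)"
    unfolding linearD(6)[OF assms(1)] linearD(6)[OF assms(2)]
    using assms(3) component_props(1) by (intro sum.cong) auto
  then show ?thesis by (simp add: component_props)
qed

text \<open>The extension is made twice, over the degree of \<open>y\<close> inside and over the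
  degree of \<open>x\<close> outside. Each extension is linear in its own variable and in the other
  one as a parameter.\<close>

lemma bilinear_graded_extension:
  assumes U: "vector_space sU" and \<phi>: "\<And>a b. bilinear_map scale scale sU (\<phi> a b)"
  obtains h where "bilinear_map scale scale sU h"
    and "\<And>a b x y. x \<in> grade a \<Longrightarrow> y \<in> grade b \<Longrightarrow> h x y = \<phi> a b x y"
proof
  let ?h = "\<lambda>x y. graded_extend (\<lambda>a x. graded_extend (\<lambda>b. \<phi> a b x) y) x"
  note lin = bilinear_mapD[OF \<phi>]
  have in_x: "Vector_Spaces.linear scale sU (\<lambda>x. graded_extend (\<lambda>b. \<phi> a b x) y)" for a y
    by (intro linear_graded_extend_parameter U lin vector_space_axioms)
  show "bilinear_map scale scale sU ?h"
    unfolding bilinear_map_def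
    by (intro conjI allI linear_graded_extend_parameter linear_graded_extend in_x U lin
        vector_space_axioms)
  show "?h x y = \<phi> a b x y" if "x \<in> grade a" "y \<in> grade b" for a b x y
    using linearD(3)[OF lin(1)] linearD(3)[OF lin(2)]
    by (simp add: graded_extend_homogeneous[OF that(1)] graded_extend_homogeneous[OF that(2)])
qed

end

text \<open>The maps \<open>P a\<close> act as projections: applied to a decomposition they recover
  its components, which gives uniqueness. Spanning gives existence.\<close>

lemma graded_spaceI:
  fixes scale :: "'k::field \<Rightarrow> 'v::ab_group_add \<Rightarrow> 'v" and grade :: "'g::ab_group_add \<Rightarrow> 'v set"
  assumes vs: "vector_space scale" and sub: "\<And>a. module.subspace scale (grade a)"
    and span: "\<And>v. v \<in> module.span scale (\<Union>a. grade a)"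
    and lin: "\<And>a. Vector_Spaces.linear scale scale (P a)"
    and P: "\<And>a b v. v \<in> grade a \<Longrightarrow> P b v = (if b = a then v else 0)"
  shows "graded_space scale grade"
proof -
  interpret vector_space scale by fact
  let ?Q = "\<lambda>v c. (\<forall>a. c a \<in> grade a) \<and> finite {a. c a \<noteq> 0} \<and> v = (\<Sum>a | c a \<noteq> 0. c a)"
  have c: "c = (\<lambda>a. P a v)" if "?Q v c" for v c
  proof
    fix b
    have "P b v = (\<Sum>a | c a \<noteq> 0. P b (c a))" using that linearD(6)[OF lin] by metis
    also have "\<dots> = (\<Sum>a | c a \<noteq> 0. if a = b then c a else 0)"
    proof (rule sum.cong[OF refl])
      fix a
      show "P b (c a) = (if a = b then c a else 0)" using that P[of "c a" a b] by simp
    qed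
    also have "\<dots> = c b" using that by (simp add: sum.delta)
    finally show "c b = P b v" by simp
  qed
  \<comment> \<open>\<open>S\<close> may exceed the support of \<open>c\<close>; with this slack the
    decomposable vectors visibly form a subspace. The exact support is restored afterwards.\<close>
  have decomposition: "\<exists>S c. finite S \<and> (\<forall>a. c a \<in> grade a) \<and> (\<forall>a. a \<notin> S \<longrightarrow> c a = 0) \<and> v = sum c S" for v
  proof (rule span_induct[OF span])
    show "subspace {v. \<exists>S c. finite S \<and> (\<forall>a. c a \<in> grade a) \<and> (\<forall>a. a \<notin> S \<longrightarrow> c a = 0) \<and> v = sum c S}"
    proof (rule subspaceI; clarify)
      show "\<exists>S c. finite S \<and> (\<forall>a. c a \<in> grade a) \<and> (\<forall>a. a \<notin> S \<longrightarrow> c a = 0) \<and> 0 = sum c S"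
        by (rule exI[of _ "{}"], rule exI[of _ "\<lambda>_. 0"]) (simp add: subspace_0[OF sub])
    next
      fix S S' :: "'g set" and c c'
      assume *: "finite S" "finite S'" "\<forall>a. c a \<in> grade a" "\<forall>a. c' a \<in> grade a"
        "\<forall>a. a \<notin> S \<longrightarrow> c a = 0" "\<forall>a. a \<notin> S' \<longrightarrow> c' a = 0"
      have "sum c S = sum c (S \<union> S')" "sum c' S' = sum c' (S \<union> S')"
        using * by (auto intro!: sum.mono_neutral_left)
      then have "sum c S + sum c' S' = (\<Sum>a\<in>S \<union> S'. c a + c' a)" by (simp add: sum.distrib)
      then show "\<exists>S'' c''. finite S'' \<and> (\<forall>a. c'' a \<in> grade a) \<and> (\<forall>a. a \<notin> S'' \<longrightarrow> c'' a = 0) \<and>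
          sum c S + sum c' S' = sum c'' S''"
        using * subspace_add[OF sub]
        by (intro exI[of _ "S \<union> S'"] exI[of _ "\<lambda>a. c a + c' a"]) auto
    next
      fix S :: "'g set" and c k
      assume *: "finite S" "\<forall>a. c a \<in> grade a" "\<forall>a. a \<notin> S \<longrightarrow> c a = 0"
      then show "\<exists>S' c'. finite S' \<and> (\<forall>a. c' a \<in> grade a) \<and> (\<forall>a. a \<notin> S' \<longrightarrow> c' a = 0) \<and>
          scale k (sum c S) = sum c' S'"
        using subspace_scale[OF sub]
        by (intro exI[of _ S] exI[of _ "\<lambda>a. scale k (c a)"]) (auto simp: scale_sum_right)
    qed
  next
    fix v assume "v \<in> (\<Union>a. grade a)"
    then obtain a where "v \<in> grade a" by blast
    then show "\<exists>S c. finite S \<and> (\<forall>a. c a \<in> grade a) \<and> (\<forall>a. a \<notin> S \<longrightarrow> c a = 0) \<and> v = sum c S"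
      using subspace_0[OF sub]
      by (intro exI[of _ "{a}"] exI[of _ "\<lambda>b. if b = a then v else 0"]) auto
  qed
  have ex: "\<exists>c. ?Q v c" for v
  proof -
    obtain S c where *: "finite S" "\<forall>a. c a \<in> grade a" "\<forall>a. a \<notin> S \<longrightarrow> c a = 0" "v = sum c S"
      using decomposition[of v] by blast
    then have "{a. c a \<noteq> 0} \<subseteq> S" by auto
    moreover have "sum c {a. c a \<noteq> 0} = sum c S"
      using * by (intro sum.mono_neutral_left) auto
    ultimately show ?thesis using * finite_subset by metis
  qed
  show ?thesis
  proof
    show "subspace (grade a)" for a by (rule sub)
    show "\<exists>!c. ?Q v c" for v using ex c by metis
  qed
qed


section \<open>The graded tensor product\<close>

context tensor_product
begin

lemmas tens_simps = bilinear_map_simps[OF tens_bilinear]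

lemma tens_span: "t \<in> T.span {tens x y | x y. True}"
proof -
  obtain F where F: "t = free_extend sT (\<lambda>(v, w). tens v w) F" using onto by (metis surjD)
  show ?thesis
    unfolding F free_extend_def by (auto intro!: T.span_sum T.span_scale intro: T.span_base)
qed

lemma tens_linear_eq:
  assumes "Vector_Spaces.linear sT sU h" "Vector_Spaces.linear sT sU k"
    and "\<And>x y. h (tens x y) = k (tens x y)"
  shows "h t = k t"
  using linear_zero_on_span[OF linear_map_diff[OF assms(1,2)] tens_span] assms(3) by auto

text \<open>The universal property is applied twice: first in \<open>y1\<close>, \<open>y2\<close>
  with \<open>x1\<close>, \<open>x2\<close> fixed, then in \<open>x1\<close>, \<open>x2\<close> with
  the tensor in the second slot fixed.\<close>

lemma quadrilinear_extension:
  assumes M: "\<And>y1 y2. bilinear_map s1 s2 sT (\<lambda>x1 x2. M x1 x2 y1 y2)"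
    and N: "\<And>x1 x2. bilinear_map s1 s2 sT (M x1 x2)"
  obtains m where "bilinear_map sT sT sT m"
    and "\<And>x1 x2 y1 y2. m (tens x1 x2) (tens y1 y2) = M x1 x2 y1 y2"
proof -
  note vs = T.vector_space_axioms
  have "\<forall>x1 x2. \<exists>h. Vector_Spaces.linear sT sT h \<and> (\<forall>y1 y2. h (tens y1 y2) = M x1 x2 y1 y2)"
    using tensor_product_universal[OF vs N] by blast
  then obtain h where h: "\<And>x1 x2. Vector_Spaces.linear sT sT (h x1 x2)"
    "\<And>x1 x2 y1 y2. h x1 x2 (tens y1 y2) = M x1 x2 y1 y2" by metis
  note Ms = bilinear_map_simps[OF M]
  \<comment> \<open>In each law both sides are linear in \<open>t\<close>, so comparing them on pure
    tensors suffices; there the law is one for \<open>M\<close>.\<close>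
  have "bilinear_map s1 s2 sT (\<lambda>x1 x2. h x1 x2 t)" for t
    unfolding bilinear_map_def
  proof (intro conjI allI linear_mapI V.vector_space_axioms W.vector_space_axioms vs)
    fix x y z w c
    show "h x (y + z) t = h x y t + h x z t"
      by (rule tens_linear_eq[of sT _ "\<lambda>t. h x y t + h x z t", OF h(1) linear_map_add[OF h(1) h(1)]])
        (simp add: h(2) Ms)
    show "h x (s2 c y) t = sT c (h x y t)"
      by (rule tens_linear_eq[of sT _ "\<lambda>t. sT c (h x y t)", OF h(1) linear_map_scale[OF h(1)]])
        (simp add: h(2) Ms)
    show "h (v + v') y t = h v y t + h v' y t" for v v'
      by (rule tens_linear_eq[of sT _ "\<lambda>t. h v y t + h v' y t", OF h(1) linear_map_add[OF h(1) h(1)]])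
        (simp add: h(2) Ms)
    show "h (s1 c v) y t = sT c (h v y t)" for v
      by (rule tens_linear_eq[of sT _ "\<lambda>t. sT c (h v y t)", OF h(1) linear_map_scale[OF h(1)]])
        (simp add: h(2) Ms)
  qed
  then have "\<forall>t. \<exists>k. Vector_Spaces.linear sT sT k \<and> (\<forall>x1 x2. k (tens x1 x2) = h x1 x2 t)"
    using tensor_product_universal[OF vs] by blast
  then obtain k where k: "\<And>t. Vector_Spaces.linear sT sT (k t)"
    "\<And>t x1 x2. k t (tens x1 x2) = h x1 x2 t" by metis
  show ?thesis
  proof (rule that)
    show "bilinear_map sT sT sT (\<lambda>s t. k t s)"
      unfolding bilinear_map_def
    proof (intro conjI allI)
      show "Vector_Spaces.linear sT sT (\<lambda>s. k t s)" for t by (rule k(1))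
      fix s
      \<comment> \<open>The laws are compared on pure tensors again, now in \<open>s\<close>, where
        they reduce to linearity of \<open>h x1 x2\<close>.\<close>
      show "Vector_Spaces.linear sT sT (\<lambda>t. k t s)"
      proof (rule linear_mapI[OF vs vs])
        fix t t' c
        show "k (t + t') s = k t s + k t' s"
          by (rule tens_linear_eq[of sT _ "\<lambda>s. k t s + k t' s", OF k(1) linear_map_add[OF k(1) k(1)]])
            (simp add: k(2) linearD[OF h(1)])
        show "k (sT c t) s = sT c (k t s)"
          by (rule tens_linear_eq[of sT _ "\<lambda>s. sT c (k t s)", OF k(1) linear_map_scale[OF k(1)]])
            (simp add: k(2) linearD[OF h(1)])
      qed
    qed
    show "k (tens y1 y2) (tens x1 x2) = M x1 x2 y1 y2" for x1 x2 y1 y2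
      by (simp add: k h)
  qed
qed

end

section \<open>The grading of the tensor product and operations prescribed on homogeneous pure
  tensors\<close>

locale graded_tensor_product =
  tensor_product s1 s2 sT tens + G1: graded_space s1 G1 + G2: graded_space s2 G2
  for s1 :: "'k::field \<Rightarrow> 'v::ab_group_add \<Rightarrow> 'v"
    and s2 :: "'k \<Rightarrow> 'w::ab_group_add \<Rightarrow> 'w"
    and sT :: "'k \<Rightarrow> 't::ab_group_add \<Rightarrow> 't" and tens
    and G1 :: "'g::ab_group_add \<Rightarrow> 'v set" and G2 :: "'g \<Rightarrow> 'w set"
begin

abbreviation GT where "GT \<equiv> tensor_grade sT tens G1 G2"

lemma tens_in_grade: "x \<in> G1 a \<Longrightarrow> y \<in> G2 b \<Longrightarrow> tens x y \<in> GT (a + b)"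
  unfolding tensor_grade_def by (rule T.span_base) blast

text \<open>With a homogeneous first factor fixed, the equality extends linearly in the second
  factor, and then in the first.\<close>

lemma homogeneous_linear_eq:
  assumes "Vector_Spaces.linear sT sU h" "Vector_Spaces.linear sT sU k"
    and eq: "\<And>x y a b. x \<in> G1 a \<Longrightarrow> y \<in> G2 b \<Longrightarrow> h (tens x y) = k (tens x y)"
  shows "h t = k t"
proof (rule tens_linear_eq[OF assms(1,2)])
  note tens = bilinear_mapD[OF tens_bilinear]
  fix v w
  have "h (tens x w) = k (tens x w)" if "x \<in> G1 a" for x a
    by (rule G2.linear_eq_on_grades[of sU "\<lambda>w. h (tens x w)" "\<lambda>w. k (tens x w)"])
      (auto intro: linear_map_compose assms tens that)
  then show "h (tens v w) = k (tens v w)"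
    by (rule_tac G1.linear_eq_on_grades[of sU "\<lambda>v. h (tens v w)" "\<lambda>v. k (tens v w)"])
      (auto intro: linear_map_compose assms tens)
qed

text \<open>This gives the uniqueness of operations prescribed on homogeneous pure tensors.\<close>

lemma bilinear_homogeneous_eq:
  assumes m: "bilinear_map sT sT sT m" and n: "bilinear_map sT sT sT n"
    and eq: "\<And>x1 x2 y1 y2 a1 a2 b1 b2. x1 \<in> G1 a1 \<Longrightarrow> x2 \<in> G2 a2 \<Longrightarrow> y1 \<in> G1 b1 \<Longrightarrow> y2 \<in> G2 b2 \<Longrightarrow>
      m (tens x1 x2) (tens y1 y2) = n (tens x1 x2) (tens y1 y2)"
  shows "m = n"
proof (intro ext)
  fix s t
  have "m (tens x1 x2) t = n (tens x1 x2) t" if "x1 \<in> G1 a1" "x2 \<in> G2 a2" for x1 x2 a1 a2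
    by (rule homogeneous_linear_eq[OF bilinear_mapD(1)[OF m] bilinear_mapD(1)[OF n]])
      (rule eq[OF that])
  then show "m s t = n s t"
    by (rule homogeneous_linear_eq[OF bilinear_mapD(2)[OF m] bilinear_mapD(2)[OF n]])
qed

lemma linear_zero_on_tensor_grade:
  assumes "Vector_Spaces.linear sT sU h" "t \<in> GT g"
    and "\<And>x y a b. x \<in> G1 a \<Longrightarrow> y \<in> G2 b \<Longrightarrow> g = a + b \<Longrightarrow> h (tens x y) = 0"
  shows "h t = 0"
  using assms by (auto intro!: linear_zero_on_span[OF assms(1), of t] simp: tensor_grade_def)

text \<open>The universal property supplies the projection to degree \<open>g\<close>: it sends
  \<open>tens x y\<close> to the sum over \<open>a\<close> of the tensors of the component of
  \<open>x\<close> in degree \<open>a\<close> with that of \<open>y\<close> in degree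
  \<open>g - a\<close>.\<close>

lemma graded_space_tensor: "graded_space sT GT"
proof -
  note vs = T.vector_space_axioms
  note tens = bilinear_mapD[OF tens_bilinear]
  define \<pi> where "\<pi> g x y = G1.graded_extend (\<lambda>a x. tens x (G2.component y (g - a))) x" for g x y
  have "bilinear_map s1 s2 sT (\<pi> g)" for g
    unfolding \<pi>_def bilinear_map_def
    by (intro conjI allI G1.linear_graded_extend G1.linear_graded_extend_parameter vs
        W.vector_space_axioms tens linear_map_compose[OF G2.linear_component])
  then have "\<forall>g. \<exists>h. Vector_Spaces.linear sT sT h \<and> (\<forall>x y. h (tens x y) = \<pi> g x y)"
    using tensor_product_universal[OF vs] by blast
  then obtain P where P: "\<And>g. Vector_Spaces.linear sT sT (P g)"
    "\<And>g x y. P g (tens x y) = \<pi> g x y" by metis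
  have tens_P: "P g (tens x y) = (if g = a + b then tens x y else 0)"
    if "x \<in> G1 a" "y \<in> G2 b" for x y a b g
  proof -
    have "P g (tens x y) = tens x (G2.component y (g - a))"
      unfolding P \<pi>_def by (rule G1.graded_extend_homogeneous[OF that(1)]) (simp add: tens_simps)
    then show ?thesis
      using G2.component_homogeneous[OF that(2)] by (auto simp: tens_simps)
  qed
  show ?thesis
  proof (rule graded_spaceI[OF vs _ _ P(1)])
    show "T.subspace (GT a)" for a by (simp add: tensor_grade_def)
    show "P b t = (if b = a then t else 0)" if "t \<in> GT a" for a b t
    proof (cases "b = a")
      case True
      have "P b t - t = 0"
        by (rule linear_zero_on_tensor_grade[OF linear_map_diff[OF P(1) T.linear_ident] that])
          (simp add: tens_P True)
      then show ?thesis using True by simp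
    next
      case False
      have "P b t = 0"
        by (rule linear_zero_on_tensor_grade[OF P(1) that]) (use False in \<open>simp add: tens_P\<close>)
      then show ?thesis using False by simp
    qed
    show "t \<in> T.span (\<Union>a. GT a)" for t
    proof -
      have "tens x y \<in> T.span (\<Union>a. GT a)" for x y
      proof -
        have "tens x y = (\<Sum>a | G1.component x a \<noteq> 0. \<Sum>b | G2.component y b \<noteq> 0.
            tens (G1.component x a) (G2.component y b))"
          by (simp flip: linearD(6)[OF tens(1)] linearD(6)[OF tens(2)]
              add: G1.component_props G2.component_props)
        also have "\<dots> \<in> T.span (\<Union>a. GT a)"
        proof (intro T.span_sum)
          fix a b
          have "tens (G1.component x a) (G2.component y b) \<in> GT (a + b)"
            by (intro tens_in_grade G1.component_props G2.component_props)
          then show "tens (G1.component x a) (G2.component y b) \<in> T.span (\<Union>a. GT a)"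
            by (blast intro: T.span_base)
        qed
        finally show ?thesis .
      qed
      then have "T.span {tens x y | x y. True} \<subseteq> T.span (\<Union>a. GT a)"
        by (intro T.span_minimal T.subspace_span) auto
      then show ?thesis using tens_span by blast
    qed
  qed
qed

text \<open>The sign is absorbed into the automorphism of \<open>V\<close> acting on degree \<open>b\<close> as \<open>\<epsilon> a b\<close>.\<close>

lemma tensor_mul_exists:
  assumes p: "bilinear_map s1 s1 s1 p" and q: "bilinear_map s2 s2 s2 q"
  obtains m where "is_tensor_mul sT tens G1 G2 \<epsilon> p q m"
proof -
  note vs = T.vector_space_axioms
  define L where "L a = G1.graded_extend (\<lambda>b. s1 (\<epsilon> a b))" for a
  \<comment> \<open>The extension runs over the degree of \<open>x2\<close>, which selects the map
    \<open>L a\<close> applied to \<open>y1\<close>; this makes the sign linear in all four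
    arguments.\<close>
  define M where
    "M x1 x2 y1 y2 = G2.graded_extend (\<lambda>a x2. tens (p x1 (L a y1)) (q x2 y2)) x2" for x1 x2 y1 y2
  note tens = bilinear_mapD[OF tens_bilinear]
  have L: "Vector_Spaces.linear s1 s1 (L a)" for a
    unfolding L_def by (intro G1.linear_graded_extend V.vector_space_axioms V.linear_scale_self)
  note lin = linear_map_compose[OF bilinear_mapD(1)[OF q] tens(1)]
    linear_map_compose[OF bilinear_mapD(2)[OF q] tens(1)]
    linear_map_compose[OF bilinear_mapD(2)[OF p] tens(2)]
    linear_map_compose[OF linear_map_compose[OF L bilinear_mapD(1)[OF p]] tens(2)]
  have "bilinear_map s1 s2 sT (\<lambda>x1 x2. M x1 x2 y1 y2)" "bilinear_map s1 s2 sT (M x1 x2)"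
    for x1 x2 y1 y2
    unfolding M_def bilinear_map_def
    by (intro conjI allI G2.linear_graded_extend G2.linear_graded_extend_parameter vs
        V.vector_space_axioms W.vector_space_axioms lin)+
  then obtain m where m: "bilinear_map sT sT sT m"
    "\<And>x1 x2 y1 y2. m (tens x1 x2) (tens y1 y2) = M x1 x2 y1 y2"
    using quadrilinear_extension[of M] by blast
  have "m (tens x1 x2) (tens y1 y2) = sT (\<epsilon> a2 b1) (tens (p x1 y1) (q x2 y2))"
    if "x2 \<in> G2 a2" "y1 \<in> G1 b1" for x1 x2 y1 y2 a2 b1
  proof -
    have "L a2 y1 = s1 (\<epsilon> a2 b1) y1"
      unfolding L_def by (rule G1.graded_extend_homogeneous[OF that(2)]) simp
    then show ?thesis
      unfolding m M_def using linearD(3)[OF lin(2)]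
      by (simp add: G2.graded_extend_homogeneous[OF that(1)] bilinear_map_simps[OF p] tens_simps)
  qed
  with m(1) show ?thesis using that unfolding is_tensor_mul_def by blast
qed

end


section \<open>Admissible algebras\<close>

text \<open>The last item expresses \<open>\<epsilon> a b\<close> and \<open>\<epsilon> b a\<close>
  through one of them, so that sign identities become field arithmetic.\<close>

lemma commutation_factorD:
  assumes "commutation_factor \<epsilon>"
  shows "\<epsilon> a b \<noteq> 0" "\<epsilon> a b * \<epsilon> b a = 1" "\<epsilon> a (b + c) = \<epsilon> a b * \<epsilon> a c"
    "\<epsilon> (a + b) c = \<epsilon> a c * \<epsilon> b c" "\<epsilon> a b = inverse (\<epsilon> b a)"
proof -
  show "\<epsilon> a b \<noteq> 0" and swap: "\<epsilon> a b * \<epsilon> b a = 1" and "\<epsilon> a (b + c) = \<epsilon> a b * \<epsilon> a c"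
    "\<epsilon> (a + b) c = \<epsilon> a c * \<epsilon> b c"
    using assms by (auto simp: commutation_factor_def)
  have "\<epsilon> b a * \<epsilon> a b = 1" using assms by (auto simp: commutation_factor_def)
  then show "\<epsilon> a b = inverse (\<epsilon> b a)" by (rule inverse_unique[symmetric])
qed

context comm_hom_assoc_color
begin

lemma mul_mul_swap:
  assumes "x \<in> grade a" "y \<in> grade b"
  shows "mul (mul x y) (\<alpha> z) = scale (\<epsilon> a b) (mul (mul y x) (\<alpha> z))"
  by (simp add: eps_comm[OF assms] bilinear_map_simps[OF bilinear_mul])

text \<open>Rebracket by Hom-associativity, commute \<open>y\<close> and \<open>z\<close>, and
  rebracket back.\<close>

lemma mul_mul_right_swap:
  assumes x: "x \<in> grade a" and y: "y \<in> grade b" and z: "z \<in> grade c"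
  shows "mul (mul x y) (\<alpha> z) = scale (\<epsilon> b c) (mul (mul x z) (\<alpha> y))"
  by (simp add: hom_assoc[OF x y z, symmetric] hom_assoc[OF x z y, symmetric] eps_comm[OF y z]
      bilinear_map_simps[OF bilinear_mul])

end

section \<open>The commutator bracket and a sufficient condition for admissibility\<close>

context hom_novikov_poisson_color
begin

lemmas eps_nonzero = commutation_factorD(1)[OF com.commutation_factor]
lemmas eps_mult_swap = commutation_factorD(2)[OF com.commutation_factor]
lemmas eps_add = commutation_factorD(3,4)[OF com.commutation_factor]
lemmas eps_swap = commutation_factorD(5)[OF com.commutation_factor]
lemmas mul_simps = bilinear_map_simps[OF com.bilinear_mul]
lemmas dia_simps = bilinear_map_simps[OF nov.bilinear_mul]

text \<open>For each pair of degrees the formula is bilinear, so the graded extension of bilinear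
  maps applies.\<close>

lemma bracket_exists:
  obtains brk where "bilinear_map scale scale scale brk"
    and "\<And>a b x y. x \<in> grade a \<Longrightarrow> y \<in> grade b \<Longrightarrow>
      brk x y = dia x y - scale (\<epsilon> a b) (dia y x)"
proof -
  note dia = bilinear_mapD[OF nov.bilinear_mul]
  have "bilinear_map scale scale scale (\<lambda>x y. dia x y - scale (\<epsilon> a b) (dia y x))" for a b
    unfolding bilinear_map_def by (intro conjI allI linear_map_diff linear_map_scale dia)
  then show ?thesis
    by (rule com.bilinear_graded_extension[OF com.vector_space_axioms]) (rule that)
qed

text \<open>The cyclic sum is a combination of the three instances of left symmetry
  obtained by rotating \<open>x\<close>, \<open>y\<close>, \<open>z\<close>.\<close>

lemma hom_jacobi_bracket:
  assumes brk: "\<And>a b x y. x \<in> grade a \<Longrightarrow> y \<in> grade b \<Longrightarrow>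
      brk x y = dia x y - scale (\<epsilon> a b) (dia y x)"
    and x: "x \<in> grade a" and y: "y \<in> grade b" and z: "z \<in> grade c"
  shows "scale (\<epsilon> c a) (brk (\<alpha> x) (brk y z)) + scale (\<epsilon> a b) (brk (\<alpha> y) (brk z x)) +
    scale (\<epsilon> b c) (brk (\<alpha> z) (brk x y)) = 0"
proof -
  have expand: "scale (\<epsilon> c a) (brk (\<alpha> x) (brk y z)) =
      scale (\<epsilon> c a) (dia (\<alpha> x) (dia y z)) - scale (\<epsilon> c a * \<epsilon> b c) (dia (\<alpha> x) (dia z y)) -
      scale (\<epsilon> a b) (dia (dia y z) (\<alpha> x)) + scale (\<epsilon> a b * \<epsilon> b c) (dia (dia z y) (\<alpha> x))"
    if x: "x \<in> grade a" and y: "y \<in> grade b" and z: "z \<in> grade c" for x y z a b c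
  proof -
    have yz: "dia y z \<in> grade (b + c)" and zy: "dia z y \<in> grade (b + c)"
      using nov.even_mul[OF y z] nov.even_mul[OF z y] by (simp_all add: add.commute)
    have "brk y z \<in> grade (b + c)"
      unfolding brk[OF y z] by (intro com.grade_diff com.grade_scale yz zy)
    then have "brk (\<alpha> x) (brk y z) =
        dia (\<alpha> x) (brk y z) - scale (\<epsilon> a (b + c)) (dia (brk y z) (\<alpha> x))"
      by (rule brk[OF com.even_twist[OF x]])
    \<comment> \<open>The outer sign \<open>\<epsilon> c a\<close> cancels the factor
      \<open>\<epsilon> a c\<close> of \<open>\<epsilon> a (b + c)\<close>.\<close>
    moreover have *: "\<epsilon> c a * (\<epsilon> a b * \<epsilon> a c) = \<epsilon> a b" "\<epsilon> c a * (\<epsilon> a b * (\<epsilon> a c * \<epsilon> b c)) = \<epsilon> a b * \<epsilon> b c"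
      using eps_nonzero by (simp_all add: eps_swap[of a c])
    ultimately show ?thesis
      by (simp add: brk[OF y z] dia_simps eps_add com.scale_right_diff_distrib mult.assoc *)
  qed
  \<comment> \<open>Left symmetry is solved for one term and multiplied by a free factor
    \<open>r\<close>, later chosen as the sign of the matching cyclic summand.\<close>
  have sym: "scale r (dia (dia x y) (\<alpha> z)) = scale r (dia (\<alpha> x) (dia y z)) +
      scale (r * \<epsilon> a b) (dia (dia y x) (\<alpha> z)) - scale (r * \<epsilon> a b) (dia (\<alpha> y) (dia x z))"
    if "x \<in> grade a" "y \<in> grade b" "z \<in> grade c" for x y z a b c r
    using arg_cong[OF nov.hom_left_symmetric[OF that], of "scale r"]
    by (simp add: com.scale_right_diff_distrib diff_eq_eq)
  show ?thesis
    unfolding expand[OF x y z] expand[OF y z x] expand[OF z x y]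
    using sym[OF x y z, of "\<epsilon> c a"] sym[OF y z x, of "\<epsilon> a b"] sym[OF z x y, of "\<epsilon> b c"]
    by (simp add: mult.commute)
qed

text \<open>The first hypothesis makes brackets vanish when multiplied by a twisted element, and
  with the second also [\<alpha>(x), y \<cdot> z] vanishes. So Hom-Leibniz reads 0 = 0, and the
  Hom-Lie axioms come from the bracket formula and left symmetry.\<close>

lemma admissibleI:
  assumes sym: "\<And>x y z a b c. x \<in> grade a \<Longrightarrow> y \<in> grade b \<Longrightarrow> z \<in> grade c \<Longrightarrow>
      mul (dia y x) (\<alpha> z) = scale (\<epsilon> b a) (mul (dia x y) (\<alpha> z))"
    and assoc: "\<And>x y z a b c. x \<in> grade a \<Longrightarrow> y \<in> grade b \<Longrightarrow> z \<in> grade c \<Longrightarrow>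
      dia (\<alpha> x) (mul y z) = mul (dia x y) (\<alpha> z)"
  shows "admissible_hom_novikov_poisson_color scale grade mul dia \<epsilon> \<alpha>"
proof -
  obtain brk where bil: "bilinear_map scale scale scale brk"
    and brk: "\<And>a b x y. x \<in> grade a \<Longrightarrow> y \<in> grade b \<Longrightarrow>
      brk x y = dia x y - scale (\<epsilon> a b) (dia y x)"
    using bracket_exists by blast
  have brk_grade: "brk x y \<in> grade (a + b)" if "x \<in> grade a" "y \<in> grade b" for x y a b
    using nov.even_mul[OF that] nov.even_mul[OF that(2,1)]
    by (simp add: brk[OF that] com.grade_diff com.grade_scale add.commute)
  have twist_brk: "mul (\<alpha> z) (brk x y) = 0"
    if x: "x \<in> grade a" and y: "y \<in> grade b" and z: "z \<in> grade c" for x y z a b c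
  proof -
    \<comment> \<open>The symmetry hypothesis has the twist on the right; \<epsilon>-commutativity
      then moves it to the left.\<close>
    have "mul (brk x y) (\<alpha> z) = 0"
      using eps_nonzero by (simp add: brk[OF x y] mul_simps sym[OF x y z] eps_mult_swap)
    then show ?thesis
      using com.eps_comm[OF com.even_twist[OF z] brk_grade[OF x y]] by simp
  qed
  have brk_mul: "brk (\<alpha> x) (mul y z) = 0"
    if x: "x \<in> grade a" and y: "y \<in> grade b" and z: "z \<in> grade c" for x y z a b c
  proof -
    \<comment> \<open>This sign is inverse to \<open>\<epsilon> a (b + c)\<close>, so the two terms
      of the bracket agree and cancel.\<close>
    have "dia (mul y z) (\<alpha> x) = scale (\<epsilon> c a * \<epsilon> b a) (mul (dia x y) (\<alpha> z))"
      by (simp add: mul_dia[OF y z x] sym[OF x y z])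
    then show ?thesis
      using eps_nonzero[of a b] eps_nonzero[of a c]
      by (simp add: brk[OF com.even_twist[OF x] com.even_mul[OF y z]] assoc[OF x y z] eps_add
          eps_swap[of a b] eps_swap[of a c] field_simps)
  qed
  have "hom_poisson_color scale grade mul brk \<epsilon> \<alpha>"
  proof unfold_locales
    fix x y z a b c assume x: "x \<in> grade a" and y: "y \<in> grade b"
    show "brk x y = - scale (\<epsilon> a b) (brk y x)"
      by (simp add: brk[OF x y] brk[OF y x] com.scale_right_diff_distrib eps_mult_swap)
    assume z: "z \<in> grade c"
    show "scale (\<epsilon> c a) (brk (\<alpha> x) (brk y z)) + scale (\<epsilon> a b) (brk (\<alpha> y) (brk z x)) +
        scale (\<epsilon> b c) (brk (\<alpha> z) (brk x y)) = 0"
      using brk x y z by (rule hom_jacobi_bracket)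
    show "brk (\<alpha> x) (mul y z) =
        scale (\<epsilon> a b) (mul (\<alpha> y) (brk x z)) + scale (\<epsilon> (a + b) c) (mul (\<alpha> z) (brk x y))"
      by (simp add: brk_mul[OF x y z] twist_brk[OF x z y] twist_brk[OF x y z])
  qed (use bil brk_grade com.commutation_factor com.linear_twist com.even_twist linearD[OF com.linear_twist] in auto)
  then show ?thesis
    using brk by unfold_locales blast
qed

end

section \<open>Symmetry of triple products in an admissible algebra\<close>

context admissible_hom_novikov_poisson_color
begin

text \<open>Both sides are \<open>dia (mul x y) (\<alpha> z)\<close>, rewritten by
  \<open>mul_dia\<close> before and after commuting \<open>x\<close> and \<open>y\<close>. So f
  admits an exchange of its outer arguments.\<close>

lemma outer_swap:
  assumes x: "x \<in> grade a" and y: "y \<in> grade b" and z: "z \<in> grade c"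
  shows "scale (\<epsilon> b c) (mul (dia x z) (\<alpha> y)) = scale (\<epsilon> a b * \<epsilon> a c) (mul (dia y z) (\<alpha> x))"
proof -
  have "scale (\<epsilon> b c) (mul (dia x z) (\<alpha> y)) = dia (mul x y) (\<alpha> z)"
    by (rule mul_dia[OF x y z, symmetric])
  also have "\<dots> = scale (\<epsilon> a b * \<epsilon> a c) (mul (dia y z) (\<alpha> x))"
    by (simp add: com.eps_comm[OF x y] dia_simps mul_dia[OF y x z])
  finally show ?thesis .
qed

lemma outer_swap':
  assumes x: "x \<in> grade a" and y: "y \<in> grade b" and z: "z \<in> grade c"
  shows "mul (dia x z) (\<alpha> y) = scale (\<epsilon> c b * \<epsilon> a b * \<epsilon> a c) (mul (dia y z) (\<alpha> x))"
proof -
  have "mul (dia x z) (\<alpha> y) = scale (\<epsilon> c b) (scale (\<epsilon> b c) (mul (dia x z) (\<alpha> y)))"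
    by (simp add: eps_mult_swap)
  then show ?thesis by (simp add: outer_swap[OF x y z] mult.assoc)
qed

text \<open>This is Hom-Leibniz written through f alone: up to signs it reads \<alpha>(x) \<diamond>
  (y \<cdot> z) - f(y,x,z) = (f(x,z,y) - f(y,x,z)) + (f(x,y,z) - f(y,x,z)).\<close>

lemma leibniz_expanded:
  assumes x: "x \<in> grade a" and y: "y \<in> grade b" and z: "z \<in> grade c"
  shows "dia (\<alpha> x) (mul y z) = mul (dia x y) (\<alpha> z) + scale (\<epsilon> b c) (mul (dia x z) (\<alpha> y)) -
    scale (\<epsilon> a b) (mul (dia y x) (\<alpha> z))"
proof -
  obtain brk where brk: "\<And>a b x y. x \<in> grade a \<Longrightarrow> y \<in> grade b \<Longrightarrow>
      brk x y = dia x y - scale (\<epsilon> a b) (dia y x)"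
    and "hom_poisson_color scale grade mul brk \<epsilon> \<alpha>"
    using admissible by blast
  then interpret P: hom_poisson_color scale grade mul brk \<epsilon> \<alpha> by simp
  have comm: "mul (\<alpha> z) (dia x y) = scale (\<epsilon> c a * \<epsilon> c b) (mul (dia x y) (\<alpha> z))"
    if "x \<in> grade a" "y \<in> grade b" "z \<in> grade c" for x y z a b c
    using com.eps_comm[OF com.even_twist[OF that(3)] nov.even_mul[OF that(1,2)]] by (simp add: eps_add)
  note nz = eps_nonzero[of a b] eps_nonzero[of b c] eps_nonzero[of a c]
  note swaps = eps_swap[of a b] eps_swap[of b c] eps_swap[of a c]
  have l: "brk (\<alpha> x) (mul y z) = dia (\<alpha> x) (mul y z) - scale (\<epsilon> a b) (mul (dia y x) (\<alpha> z))"
    using nz by (simp add: brk[OF com.even_twist[OF x] com.even_mul[OF y z]] mul_dia[OF y z x]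
        eps_add swaps field_simps)
  \<comment> \<open>The second term of the bracket gives f(z,x,y), which the exchange of outer
    arguments turns into f(y,x,z).\<close>
  have 1: "scale (\<epsilon> a b) (mul (\<alpha> y) (brk x z)) =
      scale (\<epsilon> b c) (mul (dia x z) (\<alpha> y)) - scale (\<epsilon> a b) (mul (dia y x) (\<alpha> z))"
    using nz by (simp add: brk[OF x z] mul_simps comm[OF x z y] comm[OF z x y] outer_swap'[OF z y x] swaps
        com.scale_right_diff_distrib field_simps)
  have 2: "scale (\<epsilon> (a + b) c) (mul (\<alpha> z) (brk x y)) =
      mul (dia x y) (\<alpha> z) - scale (\<epsilon> a b) (mul (dia y x) (\<alpha> z))"
    using nz by (simp add: brk[OF x y] mul_simps comm[OF x y z] comm[OF y x z] swaps eps_add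
        com.scale_right_diff_distrib field_simps)
  show ?thesis
    using P.hom_leibniz[OF x y z] unfolding l 1 2 by (simp add: algebra_simps)
qed

text \<open>Inserting the expanded Leibniz identity on both sides of \<open>dia_mul\<close> leaves,
  up to signs, f(y,x,z) - f(x,z,y) = f(x,y,z) - f(y,z,x), and the terms f(x,z,y) and f(y,z,x) agree
  by \<open>outer_swap\<close>.\<close>

lemma dia_mul_swap:
  assumes x: "x \<in> grade a" and y: "y \<in> grade b" and z: "z \<in> grade c"
  shows "mul (dia y x) (\<alpha> z) = scale (\<epsilon> b a) (mul (dia x y) (\<alpha> z))"
proof -
  have "scale (\<epsilon> a b) (mul (dia y x) (\<alpha> z)) = mul (dia x y) (\<alpha> z)"
    using dia_mul[OF x y z] outer_swap[OF x y z]
    by (simp add: leibniz_expanded[OF x y z] leibniz_expanded[OF y x z]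
        com.scale_right_diff_distrib com.scale_right_distrib eps_mult_swap)
  then have "scale (\<epsilon> b a) (scale (\<epsilon> a b) (mul (dia y x) (\<alpha> z))) = scale (\<epsilon> b a) (mul (dia x y) (\<alpha> z))"
    by simp
  then show ?thesis by (simp add: eps_mult_swap)
qed

text \<open>The last two arguments are exchanged by conjugating the exchange of the outer two with
  that of the first two.\<close>

lemma dia_mul_right_swap:
  assumes x: "x \<in> grade a" and y: "y \<in> grade b" and z: "z \<in> grade c"
  shows "mul (dia x z) (\<alpha> y) = scale (\<epsilon> c b) (mul (dia x y) (\<alpha> z))"
proof -
  note nz = eps_nonzero[of a b] eps_nonzero[of b c] eps_nonzero[of a c]
  note swaps = eps_swap[of a b] eps_swap[of b c] eps_swap[of a c]
  show ?thesis
    using nz by (simp add: dia_mul_swap[OF z x y] outer_swap'[OF z y x] dia_mul_swap[OF x y z]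
        swaps field_simps)
qed

text \<open>By symmetry the three terms of the expanded Leibniz identity become f(x,y,z) with
  coefficients 1, 1 and -1.\<close>

lemma dia_twist_mul:
  assumes x: "x \<in> grade a" and y: "y \<in> grade b" and z: "z \<in> grade c"
  shows "dia (\<alpha> x) (mul y z) = mul (dia x y) (\<alpha> z)"
  by (simp add: leibniz_expanded[OF x y z] dia_mul_swap[OF x y z] dia_mul_right_swap[OF x y z] eps_mult_swap)

lemma dia_mul_twist:
  assumes x: "x \<in> grade a" and y: "y \<in> grade b" and z: "z \<in> grade c"
  shows "dia (mul x y) (\<alpha> z) = mul (dia x y) (\<alpha> z)"
  by (simp add: mul_dia[OF x y z] dia_mul_right_swap[OF x y z] eps_mult_swap)

text \<open>Commuting the two factors gives f(y,z,x), which symmetry of f brings back to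
  f(x,y,z).\<close>

lemma mul_twist_dia:
  assumes x: "x \<in> grade a" and y: "y \<in> grade b" and z: "z \<in> grade c"
  shows "mul (\<alpha> x) (dia y z) = mul (dia x y) (\<alpha> z)"
proof -
  have "mul (\<alpha> x) (dia y z) = scale (\<epsilon> a b * \<epsilon> a c) (mul (dia y z) (\<alpha> x))"
    using com.eps_comm[OF com.even_twist[OF x] nov.even_mul[OF y z]] by (simp add: eps_add)
  also have "\<dots> = mul (dia x y) (\<alpha> z)"
    unfolding outer_swap[OF x y z, symmetric]
    by (simp add: dia_mul_right_swap[OF x y z] eps_mult_swap)
  finally show ?thesis .
qed

end


section \<open>Products on the tensor product\<close>

context graded_tensor_product
begin

lemma linear_eq_on_tensor_grade:
  assumes "Vector_Spaces.linear sT sT h" "Vector_Spaces.linear sT sT k" "t \<in> GT g"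
    and "\<And>x y a b. x \<in> G1 a \<Longrightarrow> y \<in> G2 b \<Longrightarrow> g = a + b \<Longrightarrow> h (tens x y) = k (tens x y)"
  shows "h t = k t"
  using linear_zero_on_tensor_grade[OF linear_map_diff[OF assms(1,2)] assms(3)] assms(4) by auto

lemma bilinear_eq_on_tensor_grade:
  assumes "\<And>y. Vector_Spaces.linear sT sT (\<lambda>x. F x y)" "\<And>x. Vector_Spaces.linear sT sT (F x)"
    and "\<And>y. Vector_Spaces.linear sT sT (\<lambda>x. H x y)" "\<And>x. Vector_Spaces.linear sT sT (H x)"
    and x: "x \<in> GT a" and y: "y \<in> GT b"
    and gens: "\<And>x1 x2 y1 y2 a1 a2 b1 b2. \<lbrakk>x1 \<in> G1 a1; x2 \<in> G2 a2; y1 \<in> G1 b1; y2 \<in> G2 b2;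
      a = a1 + a2; b = b1 + b2\<rbrakk> \<Longrightarrow> F (tens x1 x2) (tens y1 y2) = H (tens x1 x2) (tens y1 y2)"
  shows "F x y = H x y"
proof (rule linear_eq_on_tensor_grade[OF assms(1,3) x])
  fix x1 x2 a1 a2 assume "x1 \<in> G1 a1" "x2 \<in> G2 a2" "a = a1 + a2"
  then show "F (tens x1 x2) y = H (tens x1 x2) y"
    by (intro linear_eq_on_tensor_grade[OF assms(2,4) y] gens)
qed

text \<open>The total degrees \<open>a\<close>, \<open>b\<close>, \<open>c\<close> stay fixed, since
  \<open>H\<close> may contain signs depending on them; one argument at a time is reduced to pure
  tensors.\<close>

lemma trilinear_eq_on_tensor_grade:
  assumes "\<And>y z. Vector_Spaces.linear sT sT (\<lambda>x. F x y z)"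
    "\<And>x z. Vector_Spaces.linear sT sT (\<lambda>y. F x y z)" "\<And>x y. Vector_Spaces.linear sT sT (F x y)"
    and "\<And>y z. Vector_Spaces.linear sT sT (\<lambda>x. H x y z)"
    "\<And>x z. Vector_Spaces.linear sT sT (\<lambda>y. H x y z)" "\<And>x y. Vector_Spaces.linear sT sT (H x y)"
    and x: "x \<in> GT a" and y: "y \<in> GT b" and z: "z \<in> GT c"
    and gens: "\<And>x1 x2 y1 y2 z1 z2 a1 a2 b1 b2 c1 c2.
      \<lbrakk>x1 \<in> G1 a1; x2 \<in> G2 a2; y1 \<in> G1 b1; y2 \<in> G2 b2; z1 \<in> G1 c1; z2 \<in> G2 c2;
       a = a1 + a2; b = b1 + b2; c = c1 + c2\<rbrakk> \<Longrightarrow>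
      F (tens x1 x2) (tens y1 y2) (tens z1 z2) = H (tens x1 x2) (tens y1 y2) (tens z1 z2)"
  shows "F x y z = H x y z"
proof (rule linear_eq_on_tensor_grade[OF assms(1,4) x])
  fix x1 x2 a1 a2 assume "x1 \<in> G1 a1" "x2 \<in> G2 a2" "a = a1 + a2"
  then show "F (tens x1 x2) y z = H (tens x1 x2) y z"
    by (intro bilinear_eq_on_tensor_grade[OF assms(2,3,5,6) y z] gens)
qed

text \<open>The preimage of a graded component under a linear map is a subspace, so generators
  suffice.\<close>

lemma linear_in_grade:
  assumes "Vector_Spaces.linear sT sT f" "t \<in> GT g"
    and "\<And>x y a b. x \<in> G1 a \<Longrightarrow> y \<in> G2 b \<Longrightarrow> g = a + b \<Longrightarrow> f (tens x y) \<in> GT g'"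
  shows "f t \<in> GT g'"
proof (rule T.span_induct[OF assms(2)[unfolded tensor_grade_def]])
  have "T.subspace (GT g')" by (simp add: tensor_grade_def)
  then show "T.subspace {t. f t \<in> GT g'}"
    by (auto simp: T.subspace_def linearD[OF assms(1)])
qed (use assms(3) in auto)

end

section \<open>Two admissible algebras with operations on their tensor product known by their values
  on pure tensors\<close>

locale tensor_admissible =
  A1: admissible_hom_novikov_poisson_color s1 G1 mul1 dia1 \<epsilon> \<alpha>1 +
  A2: admissible_hom_novikov_poisson_color s2 G2 mul2 dia2 \<epsilon> \<alpha>2 +
  graded_tensor_product s1 s2 sT tens G1 G2
  for s1 :: "'k::field \<Rightarrow> 'v::ab_group_add \<Rightarrow> 'v"
    and s2 :: "'k \<Rightarrow> 'w::ab_group_add \<Rightarrow> 'w"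
    and sT :: "'k \<Rightarrow> 't::ab_group_add \<Rightarrow> 't" and tens
    and G1 :: "'g::ab_group_add \<Rightarrow> 'v set" and G2 :: "'g \<Rightarrow> 'w set"
    and \<epsilon> mul1 dia1 mul2 dia2 \<alpha>1 \<alpha>2 +
  fixes mul dia \<alpha>
  assumes twist: "is_tensor_twist sT tens \<alpha>1 \<alpha>2 \<alpha>"
    and mul: "is_tensor_mul sT tens G1 G2 \<epsilon> mul1 mul2 mul"
    and dia: "is_tensor_dia sT tens G1 G2 \<epsilon> mul1 dia1 mul2 dia2 dia"
begin

lemma linear_twist: "Vector_Spaces.linear sT sT \<alpha>"
  and twist_tens: "\<alpha> (tens x1 x2) = tens (\<alpha>1 x1) (\<alpha>2 x2)"
  using twist by (auto simp: is_tensor_twist_def)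

lemma bilinear_mul: "bilinear_map sT sT sT mul"
  and mul_tens: "\<lbrakk>x1 \<in> G1 a1; x2 \<in> G2 a2; y1 \<in> G1 b1; y2 \<in> G2 b2\<rbrakk> \<Longrightarrow>
    mul (tens x1 x2) (tens y1 y2) = sT (\<epsilon> a2 b1) (tens (mul1 x1 y1) (mul2 x2 y2))"
  using mul unfolding is_tensor_mul_def by blast+

lemma bilinear_dia: "bilinear_map sT sT sT dia"
  and dia_tens: "\<lbrakk>x1 \<in> G1 a1; x2 \<in> G2 a2; y1 \<in> G1 b1; y2 \<in> G2 b2\<rbrakk> \<Longrightarrow>
    dia (tens x1 x2) (tens y1 y2) =
    sT (\<epsilon> a2 b1) (tens (dia1 x1 y1) (mul2 x2 y2) + tens (mul1 x1 y1) (dia2 x2 y2))"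
  using dia unfolding is_tensor_dia_def by blast+

lemmas twist_simps = linearD(1,2,3,4)[OF linear_twist]
lemmas mul_simps = bilinear_map_simps[OF bilinear_mul]
lemmas dia_simps = bilinear_map_simps[OF bilinear_dia]
lemmas T_simps = T.scale_right_distrib T.scale_right_diff_distrib
lemmas eps_simps = A1.eps_add mult.assoc mult.commute mult.left_commute

text \<open>The sign of reordering \<open>(x\<^sub>1 \<otimes> x\<^sub>2)(y\<^sub>1 \<otimes> y\<^sub>2)(z\<^sub>1 \<otimes> z\<^sub>2)\<close> to \<open>x\<^sub>1y\<^sub>1z\<^sub>1 \<otimes> x\<^sub>2y\<^sub>2z\<^sub>2\<close>.\<close>

definition sgn3 where "sgn3 a2 b1 b2 c1 = \<epsilon> a2 b1 * (\<epsilon> a2 c1 * \<epsilon> b2 c1)"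

text \<open>The cross signs \<open>\<epsilon> a1 b2\<close> and \<open>\<epsilon> b2 a1\<close>
  cancel, which leaves one exchange sign for each tensor factor.\<close>

lemma sgn3_swap12:
  "\<epsilon> (a1 + a2) (b1 + b2) * sgn3 b2 a1 a2 c1 = sgn3 a2 b1 b2 c1 * (\<epsilon> a1 b1 * \<epsilon> a2 b2)"
proof -
  have "\<epsilon> (a1 + a2) (b1 + b2) * sgn3 b2 a1 a2 c1 =
      sgn3 a2 b1 b2 c1 * (\<epsilon> a1 b1 * \<epsilon> a2 b2) * (\<epsilon> a1 b2 * \<epsilon> b2 a1)"
    by (simp add: sgn3_def eps_simps)
  then show ?thesis by (simp add: A1.eps_mult_swap)
qed

lemma sgn3_swap23:
  "\<epsilon> (b1 + b2) (c1 + c2) * sgn3 a2 c1 c2 b1 = sgn3 a2 b1 b2 c1 * (\<epsilon> b1 c1 * \<epsilon> b2 c2)"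
proof -
  have "\<epsilon> (b1 + b2) (c1 + c2) * sgn3 a2 c1 c2 b1 =
      sgn3 a2 b1 b2 c1 * (\<epsilon> b1 c1 * \<epsilon> b2 c2) * (\<epsilon> b1 c2 * \<epsilon> c2 b1)"
    by (simp add: sgn3_def eps_simps)
  then show ?thesis by (simp add: A1.eps_mult_swap)
qed

text \<open>In each factor, g and f are \<epsilon>-symmetric, while h - k is the expression on each
  side of left symmetry.\<close>

abbreviation "g1 x y z \<equiv> mul1 (mul1 x y) (\<alpha>1 z)"
abbreviation "g2 x y z \<equiv> mul2 (mul2 x y) (\<alpha>2 z)"
abbreviation "f1 x y z \<equiv> mul1 (dia1 x y) (\<alpha>1 z)"
abbreviation "f2 x y z \<equiv> mul2 (dia2 x y) (\<alpha>2 z)"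
abbreviation "h1 x y z \<equiv> dia1 (dia1 x y) (\<alpha>1 z)"
abbreviation "h2 x y z \<equiv> dia2 (dia2 x y) (\<alpha>2 z)"
abbreviation "k1 x y z \<equiv> dia1 (\<alpha>1 x) (dia1 y z)"
abbreviation "k2 x y z \<equiv> dia2 (\<alpha>2 x) (dia2 y z)"

section \<open>Triple products of homogeneous pure tensors\<close>

context
  fixes x1 x2 y1 y2 z1 z2 a1 a2 b1 b2 c1 c2
  assumes x1: "x1 \<in> G1 a1" and x2: "x2 \<in> G2 a2" and y1: "y1 \<in> G1 b1" and y2: "y2 \<in> G2 b2"
    and z1: "z1 \<in> G1 c1" and z2: "z2 \<in> G2 c2"
begin

lemma products_in_grade:
  "mul1 x1 y1 \<in> G1 (a1 + b1)" "dia1 x1 y1 \<in> G1 (a1 + b1)"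
  "mul2 x2 y2 \<in> G2 (a2 + b2)" "dia2 x2 y2 \<in> G2 (a2 + b2)"
  "mul1 y1 z1 \<in> G1 (b1 + c1)" "dia1 y1 z1 \<in> G1 (b1 + c1)"
  "mul2 y2 z2 \<in> G2 (b2 + c2)" "dia2 y2 z2 \<in> G2 (b2 + c2)"
  by (intro A1.com.even_mul A1.nov.even_mul A2.com.even_mul A2.nov.even_mul x1 x2 y1 y2 z1 z2)+

lemmas twist_in_grade = A1.com.even_twist[OF x1] A2.com.even_twist[OF x2]
  A1.com.even_twist[OF z1] A2.com.even_twist[OF z2]

lemmas products = mul_tens[OF x1 x2 y1 y2] dia_tens[OF x1 x2 y1 y2]
  mul_tens[OF y1 y2 z1 z2] dia_tens[OF y1 y2 z1 z2]

lemmas right_products =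
  mul_tens[OF products_in_grade(1,3) twist_in_grade(3,4)] mul_tens[OF products_in_grade(1,4) twist_in_grade(3,4)]
  mul_tens[OF products_in_grade(2,3) twist_in_grade(3,4)]
  dia_tens[OF products_in_grade(1,3) twist_in_grade(3,4)] dia_tens[OF products_in_grade(1,4) twist_in_grade(3,4)]
  dia_tens[OF products_in_grade(2,3) twist_in_grade(3,4)]

lemmas left_products =
  mul_tens[OF twist_in_grade(1,2) products_in_grade(5,7)]
  dia_tens[OF twist_in_grade(1,2) products_in_grade(5,7)] dia_tens[OF twist_in_grade(1,2) products_in_grade(5,8)]
  dia_tens[OF twist_in_grade(1,2) products_in_grade(6,7)]

text \<open>These bring every other bracketing with at most one \<diamond> to the form g or f in
  each factor.\<close>

lemmas factors =
  A1.com.hom_assoc[OF x1 y1 z1] A1.dia_twist_mul[OF x1 y1 z1] A1.dia_mul_twist[OF x1 y1 z1]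
  A1.mul_twist_dia[OF x1 y1 z1]
  A2.com.hom_assoc[OF x2 y2 z2] A2.dia_twist_mul[OF x2 y2 z2] A2.dia_mul_twist[OF x2 y2 z2]
  A2.mul_twist_dia[OF x2 y2 z2]

lemmas triple_simps = products twist_tens right_products left_products factors mul_simps dia_simps
  T_simps sgn3_def eps_simps add_ac

text \<open>The order of the arguments never changes, so all bracketings share one sign. With two
  \<diamond>, the mixed terms are those where one falls in each factor, and each of them is f
  \<otimes> f.\<close>

lemma triple_products:
  "mul (mul (tens x1 x2) (tens y1 y2)) (\<alpha> (tens z1 z2)) =
    sT (sgn3 a2 b1 b2 c1) (tens (g1 x1 y1 z1) (g2 x2 y2 z2))"
  "mul (\<alpha> (tens x1 x2)) (mul (tens y1 y2) (tens z1 z2)) =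
    sT (sgn3 a2 b1 b2 c1) (tens (g1 x1 y1 z1) (g2 x2 y2 z2))"
  "mul (dia (tens x1 x2) (tens y1 y2)) (\<alpha> (tens z1 z2)) =
    sT (sgn3 a2 b1 b2 c1) (tens (f1 x1 y1 z1) (g2 x2 y2 z2) + tens (g1 x1 y1 z1) (f2 x2 y2 z2))"
  "dia (mul (tens x1 x2) (tens y1 y2)) (\<alpha> (tens z1 z2)) =
    sT (sgn3 a2 b1 b2 c1) (tens (f1 x1 y1 z1) (g2 x2 y2 z2) + tens (g1 x1 y1 z1) (f2 x2 y2 z2))"
  "dia (\<alpha> (tens x1 x2)) (mul (tens y1 y2) (tens z1 z2)) =
    sT (sgn3 a2 b1 b2 c1) (tens (f1 x1 y1 z1) (g2 x2 y2 z2) + tens (g1 x1 y1 z1) (f2 x2 y2 z2))"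
  "dia (dia (tens x1 x2) (tens y1 y2)) (\<alpha> (tens z1 z2)) =
    sT (sgn3 a2 b1 b2 c1) (tens (h1 x1 y1 z1) (g2 x2 y2 z2) + tens (f1 x1 y1 z1) (f2 x2 y2 z2) +
      tens (f1 x1 y1 z1) (f2 x2 y2 z2) + tens (g1 x1 y1 z1) (h2 x2 y2 z2))"
  "dia (\<alpha> (tens x1 x2)) (dia (tens y1 y2) (tens z1 z2)) =
    sT (sgn3 a2 b1 b2 c1) (tens (k1 x1 y1 z1) (g2 x2 y2 z2) + tens (f1 x1 y1 z1) (f2 x2 y2 z2) +
      tens (f1 x1 y1 z1) (f2 x2 y2 z2) + tens (g1 x1 y1 z1) (k2 x2 y2 z2))"
  by (simp_all add: triple_simps)

end

section \<open>The identities on homogeneous pure tensors\<close>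

context
  fixes x1 x2 y1 y2 z1 z2 a1 a2 b1 b2 c1 c2
  assumes x1: "x1 \<in> G1 a1" and x2: "x2 \<in> G2 a2" and y1: "y1 \<in> G1 b1" and y2: "y2 \<in> G2 b2"
    and z1: "z1 \<in> G1 c1" and z2: "z2 \<in> G2 c2"
begin

lemma mul_tens_comm:
  "mul (tens x1 x2) (tens y1 y2) = sT (\<epsilon> (a1 + a2) (b1 + b2)) (mul (tens y1 y2) (tens x1 x2))"
proof -
  \<comment> \<open>The last bracket isolates the pair of cross signs with product 1.\<close>
  have "\<epsilon> (a1 + a2) (b1 + b2) * \<epsilon> b2 a1 = \<epsilon> a2 b1 * (\<epsilon> a1 b1 * \<epsilon> a2 b2) * (\<epsilon> a1 b2 * \<epsilon> b2 a1)"
    by (simp add: eps_simps)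
  then show ?thesis
    by (simp add: mul_tens[OF x1 x2 y1 y2] mul_tens[OF y1 y2 x1 x2] A1.com.eps_comm[OF x1 y1]
        A2.com.eps_comm[OF x2 y2] tens_simps A1.eps_mult_swap)
qed

text \<open>Exchanging the first two arguments costs f and g the same sign in each factor, so both
  summands change by the same scalar.\<close>

lemma dia_mul_tens_swap:
  "mul (dia (tens x1 x2) (tens y1 y2)) (\<alpha> (tens z1 z2)) =
    sT (\<epsilon> (a1 + a2) (b1 + b2)) (mul (dia (tens y1 y2) (tens x1 x2)) (\<alpha> (tens z1 z2)))"
  unfolding triple_products[OF x1 x2 y1 y2 z1 z2] triple_products[OF y1 y2 x1 x2 z1 z2]
    A1.dia_mul_swap[OF y1 x1 z1] A2.dia_mul_swap[OF y2 x2 z2]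
    A1.com.mul_mul_swap[OF x1 y1] A2.com.mul_mul_swap[OF x2 y2]
  by (simp add: tens_simps T_simps sgn3_swap12) (simp add: mult_ac)

lemma mul_dia_tens:
  "dia (mul (tens x1 x2) (tens y1 y2)) (\<alpha> (tens z1 z2)) =
    sT (\<epsilon> (b1 + b2) (c1 + c2)) (mul (dia (tens x1 x2) (tens z1 z2)) (\<alpha> (tens y1 y2)))"
  unfolding triple_products[OF x1 x2 y1 y2 z1 z2] triple_products[OF x1 x2 z1 z2 y1 y2]
    A1.dia_mul_right_swap[OF x1 z1 y1] A2.dia_mul_right_swap[OF x2 z2 y2]
    A1.com.mul_mul_right_swap[OF x1 y1 z1] A2.com.mul_mul_right_swap[OF x2 y2 z2]
  by (simp add: tens_simps T_simps sgn3_swap23) (simp add: mult_ac)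

lemma left_symmetric_tens:
  "dia (dia (tens x1 x2) (tens y1 y2)) (\<alpha> (tens z1 z2)) -
      dia (\<alpha> (tens x1 x2)) (dia (tens y1 y2) (tens z1 z2)) =
    sT (\<epsilon> (a1 + a2) (b1 + b2)) (dia (dia (tens y1 y2) (tens x1 x2)) (\<alpha> (tens z1 z2)) -
      dia (\<alpha> (tens y1 y2)) (dia (tens x1 x2) (tens z1 z2)))"
proof -
  \<comment> \<open>The mixed terms f \<otimes> f cancel in the difference, so only the associators
    of the two factors remain.\<close>
  have assoc: "dia (dia (tens x1 x2) (tens y1 y2)) (\<alpha> (tens z1 z2)) -
      dia (\<alpha> (tens x1 x2)) (dia (tens y1 y2) (tens z1 z2)) =
    sT (sgn3 a2 b1 b2 c1) (tens (h1 x1 y1 z1 - k1 x1 y1 z1) (g2 x2 y2 z2) +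
      tens (g1 x1 y1 z1) (h2 x2 y2 z2 - k2 x2 y2 z2))"
    if x1: "x1 \<in> G1 a1" and x2: "x2 \<in> G2 a2" and y1: "y1 \<in> G1 b1" and y2: "y2 \<in> G2 b2"
    for x1 x2 y1 y2 a1 a2 b1 b2
    unfolding triple_products[OF x1 x2 y1 y2 z1 z2] by (simp add: tens_simps T_simps)
  show ?thesis
    unfolding assoc[OF x1 x2 y1 y2] assoc[OF y1 y2 x1 x2]
      A1.nov.hom_left_symmetric[OF x1 y1 z1] A2.nov.hom_left_symmetric[OF x2 y2 z2]
      A1.com.mul_mul_swap[OF x1 y1] A2.com.mul_mul_swap[OF x2 y2]
    by (simp add: tens_simps T_simps sgn3_swap12) (simp add: mult_ac)
qed


text \<open>Here the mixed terms f \<otimes> f do not cancel; they match because f is symmetric in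
  its last two arguments in both factors.\<close>

lemma right_comm_tens:
  "dia (dia (tens x1 x2) (tens y1 y2)) (\<alpha> (tens z1 z2)) =
    sT (\<epsilon> (b1 + b2) (c1 + c2)) (dia (dia (tens x1 x2) (tens z1 z2)) (\<alpha> (tens y1 y2)))"
  unfolding triple_products[OF x1 x2 y1 y2 z1 z2] triple_products[OF x1 x2 z1 z2 y1 y2]
    A1.dia_mul_right_swap[OF x1 z1 y1] A2.dia_mul_right_swap[OF x2 z2 y2]
    A1.com.mul_mul_right_swap[OF x1 y1 z1] A2.com.mul_mul_right_swap[OF x2 y2 z2]
    A1.nov.hom_right_comm[OF x1 y1 z1] A2.nov.hom_right_comm[OF x2 y2 z2]
  by (simp add: tens_simps T_simps sgn3_swap23) (simp add: mult_ac)

end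

section \<open>Extension of the identities to all homogeneous elements of the tensor product\<close>

lemma linear_intros:
  assumes "Vector_Spaces.linear sT sT f"
  shows "Vector_Spaces.linear sT sT (\<lambda>x. \<alpha> (f x))"
    "Vector_Spaces.linear sT sT (\<lambda>x. mul (f x) y)" "Vector_Spaces.linear sT sT (\<lambda>x. mul y (f x))"
    "Vector_Spaces.linear sT sT (\<lambda>x. dia (f x) y)" "Vector_Spaces.linear sT sT (\<lambda>x. dia y (f x))"
  using linear_map_compose[OF assms] linear_twist bilinear_mapD[OF bilinear_mul]
    bilinear_mapD[OF bilinear_dia] by blast+

lemmas multilinear = linear_intros linear_map_diff linear_map_scale T.linear_ident

lemma even_twist: "x \<in> GT a \<Longrightarrow> \<alpha> x \<in> GT a"
  by (erule linear_in_grade[OF linear_twist])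
    (simp add: twist_tens tens_in_grade A1.com.even_twist A2.com.even_twist)

lemma even_operation:
  assumes m: "bilinear_map sT sT sT m" and x: "x \<in> GT a" and y: "y \<in> GT b"
    and gens: "\<And>x1 x2 y1 y2 a1 a2 b1 b2. \<lbrakk>x1 \<in> G1 a1; x2 \<in> G2 a2; y1 \<in> G1 b1; y2 \<in> G2 b2\<rbrakk> \<Longrightarrow>
      m (tens x1 x2) (tens y1 y2) \<in> GT ((a1 + b1) + (a2 + b2))"
  shows "m x y \<in> GT (a + b)"
proof (rule linear_in_grade[OF bilinear_mapD(2)[OF m] x])
  fix x1 x2 a1 a2 assume *: "x1 \<in> G1 a1" "x2 \<in> G2 a2" "a = a1 + a2"
  show "m (tens x1 x2) y \<in> GT (a + b)"
  proof (rule linear_in_grade[OF bilinear_mapD(1)[OF m] y])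
    fix y1 y2 b1 b2 assume "y1 \<in> G1 b1" "y2 \<in> G2 b2" "b = b1 + b2"
    with * gens[of x1 a1 x2 a2 y1 b1 y2 b2] show "m (tens x1 x2) (tens y1 y2) \<in> GT (a + b)"
      by (simp add: add_ac)
  qed
qed

lemma even_mul: "x \<in> GT a \<Longrightarrow> y \<in> GT b \<Longrightarrow> mul x y \<in> GT (a + b)"
  by (rule even_operation[OF bilinear_mul])
    (simp_all add: mul_tens graded_space.grade_scale[OF graded_space_tensor] tens_in_grade
      A1.com.even_mul A2.com.even_mul)

lemma even_dia: "x \<in> GT a \<Longrightarrow> y \<in> GT b \<Longrightarrow> dia x y \<in> GT (a + b)"
  by (rule even_operation[OF bilinear_dia])
    (simp_all add: dia_tens graded_space.grade_scale[OF graded_space_tensor]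
      graded_space.grade_add[OF graded_space_tensor] tens_in_grade
      A1.com.even_mul A2.com.even_mul A1.nov.even_mul A2.nov.even_mul)

lemma mul_comm:
  assumes "x \<in> GT a" "y \<in> GT b"
  shows "mul x y = sT (\<epsilon> a b) (mul y x)"
  by (rule bilinear_eq_on_tensor_grade[where F = "\<lambda>x y. mul x y" and H = "\<lambda>x y. sT (\<epsilon> a b) (mul y x)"])
    (use assms in \<open>auto intro!: multilinear intro: mul_tens_comm\<close>)

context
  fixes x y z a b c
  assumes xyz: "x \<in> GT a" "y \<in> GT b" "z \<in> GT c"
begin

lemma hom_assoc: "mul (\<alpha> x) (mul y z) = mul (mul x y) (\<alpha> z)"
proof (rule trilinear_eq_on_tensor_grade[where F = "\<lambda>x y z. mul (\<alpha> x) (mul y z)", OF _ _ _ _ _ _ xyz],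
    (intro multilinear)+)
qed (simp only: triple_products)

lemma dia_mul_swap:
  "mul (dia x y) (\<alpha> z) = sT (\<epsilon> a b) (mul (dia y x) (\<alpha> z))"
proof (rule trilinear_eq_on_tensor_grade[where F = "\<lambda>x y z. mul (dia x y) (\<alpha> z)"
      and H = "\<lambda>x y z. sT (\<epsilon> a b) (mul (dia y x) (\<alpha> z))", OF _ _ _ _ _ _ xyz],
    (intro multilinear)+)
qed (simp, rule dia_mul_tens_swap)

lemma mul_dia:
  "dia (mul x y) (\<alpha> z) = sT (\<epsilon> b c) (mul (dia x z) (\<alpha> y))"
proof (rule trilinear_eq_on_tensor_grade[where F = "\<lambda>x y z. dia (mul x y) (\<alpha> z)"
      and H = "\<lambda>x y z. sT (\<epsilon> b c) (mul (dia x z) (\<alpha> y))", OF _ _ _ _ _ _ xyz],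
    (intro multilinear)+)
qed (simp, rule mul_dia_tens)

lemma dia_twist_mul: "dia (\<alpha> x) (mul y z) = mul (dia x y) (\<alpha> z)"
proof (rule trilinear_eq_on_tensor_grade[where F = "\<lambda>x y z. dia (\<alpha> x) (mul y z)", OF _ _ _ _ _ _ xyz],
    (intro multilinear)+)
qed (simp only: triple_products)

lemma left_symmetric:
  "dia (dia x y) (\<alpha> z) - dia (\<alpha> x) (dia y z) =
    sT (\<epsilon> a b) (dia (dia y x) (\<alpha> z) - dia (\<alpha> y) (dia x z))"
proof (rule trilinear_eq_on_tensor_grade[where F = "\<lambda>x y z. dia (dia x y) (\<alpha> z) - dia (\<alpha> x) (dia y z)"
      and H = "\<lambda>x y z. sT (\<epsilon> a b) (dia (dia y x) (\<alpha> z) - dia (\<alpha> y) (dia x z))", OF _ _ _ _ _ _ xyz],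
    (intro multilinear)+)
qed (simp, rule left_symmetric_tens)

lemma right_comm:
  "dia (dia x y) (\<alpha> z) = sT (\<epsilon> b c) (dia (dia x z) (\<alpha> y))"
proof (rule trilinear_eq_on_tensor_grade[where F = "\<lambda>x y z. dia (dia x y) (\<alpha> z)"
      and H = "\<lambda>x y z. sT (\<epsilon> b c) (dia (dia x z) (\<alpha> y))", OF _ _ _ _ _ _ xyz],
    (intro multilinear)+)
qed (simp, rule right_comm_tens)

end

lemma admissible: "admissible_hom_novikov_poisson_color sT GT mul dia \<epsilon> \<alpha>"
proof -
  interpret graded_space sT GT by (rule graded_space_tensor)
  interpret hom_novikov_poisson_color sT GT mul dia \<epsilon> \<alpha>
  proof unfold_locales
    fix x y z a b c assume xyz: "x \<in> GT a" "y \<in> GT b" "z \<in> GT c"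
    \<comment> \<open>By \<open>dia_twist_mul\<close> the differences on both sides are
      zero.\<close>
    show "mul (dia x y) (\<alpha> z) - dia (\<alpha> x) (mul y z) =
        sT (\<epsilon> a b) (mul (dia y x) (\<alpha> z) - dia (\<alpha> y) (mul x z))"
      using xyz by (simp add: dia_twist_mul)
  qed (fact A1.com.commutation_factor bilinear_mul bilinear_dia even_mul even_dia even_twist
      twist_simps(1,2) hom_assoc mul_comm left_symmetric right_comm mul_dia)+
  show ?thesis
    by (rule admissibleI[OF dia_mul_swap dia_twist_mul])
qed

end

text \<open>The operations are prescribed on pure tensors only, so their existence and uniqueness
  belong to the claim; the final conjunct then speaks about the unique such operations.\<close>

theorem theorem3p22:
  fixes s1 :: "'k::{alg_closed_field, field_char_0} \<Rightarrow> 'v::ab_group_add \<Rightarrow> 'v"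
    and s2 :: "'k \<Rightarrow> 'w::ab_group_add \<Rightarrow> 'w"
    and sT :: "'k \<Rightarrow> 't::ab_group_add \<Rightarrow> 't"
    and G1 :: "'g::ab_group_add \<Rightarrow> 'v set" and G2 :: "'g \<Rightarrow> 'w set"
    and \<epsilon> :: "'g \<Rightarrow> 'g \<Rightarrow> 'k"
    and mul1 dia1 :: "'v \<Rightarrow> 'v \<Rightarrow> 'v" and mul2 dia2 :: "'w \<Rightarrow> 'w \<Rightarrow> 'w"
    and \<alpha>1 :: "'v \<Rightarrow> 'v" and \<alpha>2 :: "'w \<Rightarrow> 'w"
    and tens :: "'v \<Rightarrow> 'w \<Rightarrow> 't"
  assumes A1: "admissible_hom_novikov_poisson_color s1 G1 mul1 dia1 \<epsilon> \<alpha>1"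
    and A2: "admissible_hom_novikov_poisson_color s2 G2 mul2 dia2 \<epsilon> \<alpha>2"
    and T: "tensor_product s1 s2 sT tens"
  shows
    "(\<exists>!\<alpha>. is_tensor_twist sT tens \<alpha>1 \<alpha>2 \<alpha>) \<and>
     (\<exists>!mul. is_tensor_mul sT tens G1 G2 \<epsilon> mul1 mul2 mul) \<and>
     (\<exists>!dia. is_tensor_dia sT tens G1 G2 \<epsilon> mul1 dia1 mul2 dia2 dia) \<and>
     (\<forall>mul dia \<alpha>.
        is_tensor_twist sT tens \<alpha>1 \<alpha>2 \<alpha> \<longrightarrow>
        is_tensor_mul sT tens G1 G2 \<epsilon> mul1 mul2 mul \<longrightarrow>
        is_tensor_dia sT tens G1 G2 \<epsilon> mul1 dia1 mul2 dia2 dia \<longrightarrow>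
        admissible_hom_novikov_poisson_color sT (tensor_grade sT tens G1 G2) mul dia \<epsilon> \<alpha>)"
proof (intro conjI allI impI)
  interpret A1: admissible_hom_novikov_poisson_color s1 G1 mul1 dia1 \<epsilon> \<alpha>1 by fact
  interpret A2: admissible_hom_novikov_poisson_color s2 G2 mul2 dia2 \<epsilon> \<alpha>2 by fact
  interpret tensor_product s1 s2 sT tens by fact
  interpret graded_tensor_product s1 s2 sT tens G1 G2 by unfold_locales
  note tens = bilinear_mapD[OF tens_bilinear]
  have "bilinear_map s1 s2 sT (\<lambda>x y. tens (\<alpha>1 x) (\<alpha>2 y))"
    unfolding bilinear_map_def
    using linear_map_compose[OF A1.com.linear_twist tens(2)]
      linear_map_compose[OF A2.com.linear_twist tens(1)] by blast
  from tensor_product_universal[OF T.vector_space_axioms this]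
  show "\<exists>!\<alpha>. is_tensor_twist sT tens \<alpha>1 \<alpha>2 \<alpha>" unfolding is_tensor_twist_def .
  show "\<exists>!mul. is_tensor_mul sT tens G1 G2 \<epsilon> mul1 mul2 mul"
  proof (rule ex_ex1I)
    show "\<exists>m. is_tensor_mul sT tens G1 G2 \<epsilon> mul1 mul2 m"
      using tensor_mul_exists[OF A1.com.bilinear_mul A2.com.bilinear_mul] by blast
    fix m n assume "is_tensor_mul sT tens G1 G2 \<epsilon> mul1 mul2 m" "is_tensor_mul sT tens G1 G2 \<epsilon> mul1 mul2 n"
    then show "m = n"
      unfolding is_tensor_mul_def by (intro bilinear_homogeneous_eq) auto
  qed
  show "\<exists>!dia. is_tensor_dia sT tens G1 G2 \<epsilon> mul1 dia1 mul2 dia2 dia"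
  proof (rule ex_ex1I)
    \<comment> \<open>The formula for \<diamond> is the sum of two products of the shape already
      constructed: (\<diamond>, \<cdot>) and (\<cdot>, \<diamond>) on the two factors.\<close>
    obtain m n where "is_tensor_mul sT tens G1 G2 \<epsilon> dia1 mul2 m" "is_tensor_mul sT tens G1 G2 \<epsilon> mul1 dia2 n"
      using tensor_mul_exists[OF A1.nov.bilinear_mul A2.com.bilinear_mul]
        tensor_mul_exists[OF A1.com.bilinear_mul A2.nov.bilinear_mul] by metis
    then have "is_tensor_dia sT tens G1 G2 \<epsilon> mul1 dia1 mul2 dia2 (\<lambda>s t. m s t + n s t)"
      unfolding is_tensor_mul_def is_tensor_dia_def bilinear_map_def
      by (auto intro!: linear_map_add simp: T.scale_right_distrib)
    then show "\<exists>d. is_tensor_dia sT tens G1 G2 \<epsilon> mul1 dia1 mul2 dia2 d" by blast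
    fix m n assume "is_tensor_dia sT tens G1 G2 \<epsilon> mul1 dia1 mul2 dia2 m"
      "is_tensor_dia sT tens G1 G2 \<epsilon> mul1 dia1 mul2 dia2 n"
    then show "m = n"
      unfolding is_tensor_dia_def by (intro bilinear_homogeneous_eq) auto
  qed
  fix mul dia \<alpha>
  assume "is_tensor_twist sT tens \<alpha>1 \<alpha>2 \<alpha>" "is_tensor_mul sT tens G1 G2 \<epsilon> mul1 mul2 mul"
    "is_tensor_dia sT tens G1 G2 \<epsilon> mul1 dia1 mul2 dia2 dia"
  then interpret tensor_admissible s1 s2 sT tens G1 G2 \<epsilon> mul1 dia1 mul2 dia2 \<alpha>1 \<alpha>2 mul dia \<alpha>
    by unfold_locales
  show "admissible_hom_novikov_poisson_color sT (tensor_grade sT tens G1 G2) mul dia \<epsilon> \<alpha>"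
    by (rule admissible)
qed

end
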